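(* Let $\mathcal{L}$ be any set of sequents such that $\mathbf{ACT} \subseteq \mathcal{L} \subseteq \mathbf{ACT}_\omega\mathbf{D}$. Then $\mathcal{L}$ is undecidable. Moreover, if $\mathcal{L}$ is recursively enumerable, then it is $\Sigma_1^0$-complete.
   Context: Formulae are built from propositional variables and constants $\mathbf{0},\mathbf{1}$ using binary connectives $\cdot$, $\backslash$, $/$, $\vee$, $\wedge$ and unary ${}^*$. A sequent is $\Gamma\vdash\beta$ with $\Gamma$ a finite, possibly empty (denoted $\Lambda$), sequence of formulae and $\beta$ a formula. The calculus $\mathbf{MALC}$ has axioms $\alpha\vdash\alpha$, $\Gamma,\mathbf{0},\Delta\vdash\gamma$, $\Lambda\vdash\mathbf{1}$, and rules: from $\Gamma,\Delta\vdash\gamma$ infer $\Gamma,\mathbf{1},\Delta\vdash\gamma$; from $\Pi\vdash\alpha$ and $\Gamma,\beta,\Delta\vdash\gamma$ infer $\Gamma,\Pi,\alpha\backslash\beta,\Delta\vdash\gamma$ and also $\Gamma,\beta/\alpha,\Pi,\Delta\vdash\gamma$; from $\alpha,\Pi\vdash\beta$ infer $\Pi\vdash\alpha\backslash\beta$; from $\Pi,\alpha\vdash\beta$ infer $\Pi\vdash\beta/\alpha$; from $\Gamma,\alpha,\beta,\Delta\vdash\gamma$ infer $\Gamma,\alpha\cdot\beta,\Delta\vdash\gamma$; from $\Gamma\vdash\alpha$ and $\Delta\vdash\beta$ infer $\Gamma,\Delta\vdash\alpha\cdot\beta$; from $\Gamma,\alpha_i,\Delta\vdash\gamma$ ($i=1,2$)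 infer $\Gamma,\alpha_1\wedge\alpha_2,\Delta\vdash\gamma$; from $\Pi\vdash\alpha_1$ and $\Pi\vdash\alpha_2$ infer $\Pi\vdash\alpha_1\wedge\alpha_2$; from $\Gamma,\alpha_1,\Delta\vdash\gamma$ and $\Gamma,\alpha_2,\Delta\vdash\gamma$ infer $\Gamma,\alpha_1\vee\alpha_2,\Delta\vdash\gamma$; from $\Pi\vdash\alpha_i$ ($i=1,2$) infer $\Pi\vdash\alpha_1\vee\alpha_2$. Action logic $\mathbf{ACT}$ is $\mathbf{MALC}$ extended with: from $\Lambda\vdash\beta$ and $\alpha,\beta\vdash\beta$ infer $\alpha^*\vdash\beta$; cut (from $\Pi\vdash\alpha$ and $\Gamma,\alpha,\Delta\vdash\gamma$ infer $\Gamma,\Pi,\Delta\vdash\gamma$); the axiom $\Lambda\vdash\alpha^*$; from $\Pi\vdash\alpha$ and $\Delta\vdash\alpha^*$ infer $\Pi,\Delta\vdash\alpha^*$. Infinitary action logic $\mathbf{ACT}_\omega$ is $\mathbf{MALC}$ extended with the $\omega$-rule: from $\Gamma,\alpha^n,\Delta\vdash\gamma$ for all $n\in\omega$ infer $\Gamma,\alpha^*,\Delta\vdash\gamma$ ($\alpha^n$ = $n$ consecutive copies of $\alpha$), and, for each $n\ge0$, from $\Pi_1\vdash\alpha,\dots,\Pi_n\vdash\alpha$ infer $\Pi_1,\dots,\Pi_n\vdash\alpha^*$; derivations are possibly infinite well-founded trees. $\mathbf{D}$ denotes the distributivity axiom scheme $(\alpha\vee\beta)\wedge(\alpha\vee\gamma)\vdash\alpha\vee(\beta\wedge\gamma)$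 for all formulae $\alpha,\beta,\gamma$; $\mathbf{ACT}_\omega\mathbf{D}$ is $\mathbf{ACT}_\omega$ extended with all instances of $\mathbf{D}$ as additional axioms (and with the cut rule). Logics are sets of sequents; inclusions are set inclusions. $\Sigma_1^0$-complete means r.e. and every r.e. set is many-one reducible to it. *)

theory Defs
  imports Main "HOL-Library.Nat_Bijection"
begin

(* LDiv a b is a\b and RDiv b a is b/a: the denominator is the first argument of LDiv
   and the second argument of RDiv. There are countably many variables. *)
datatype form =
    Var nat
  | Zero
  | One
  | Prod form form (infixl "\<bullet>" 75)
  | LDiv form form (infixr "\<rightharpoondown>" 70)
  | RDiv form form (infixl "\<leftharpoondown>" 70)
  | Disj form form (infixl "\<squnion>" 65)
  | Conj form form (infixl "\<sqinter>" 68)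
  | Star form

datatype sequent = Sequent "form list" form (infix "\<turnstile>" 55)

(* A rule system R relates the set of premises of each rule instance to its conclusion.
   Premise sets may be infinite, so derivations are well-founded trees, possibly of
   infinite width. *)
type_synonym rules = "sequent set \<Rightarrow> sequent \<Rightarrow> bool"

inductive derivable :: "rules \<Rightarrow> sequent \<Rightarrow> bool" for R :: rules where
  step: "R P s \<Longrightarrow> (\<And>p. p \<in> P \<Longrightarrow> derivable R p) \<Longrightarrow> derivable R s"

inductive malc :: rules where
  ax: "malc {} ([\<alpha>] \<turnstile> \<alpha>)"
| zeroL: "malc {} (\<Gamma> @ [Zero] @ \<Delta> \<turnstile> \<gamma>)"
| oneR: "malc {} ([] \<turnstile> One)"
| oneL: "malc {\<Gamma> @ \<Delta> \<turnstile> \<gamma>} (\<Gamma> @ [One] @ \<Delta> \<turnstile> \<gamma>)"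
| ldivL: "malc {\<Pi> \<turnstile> \<alpha>, \<Gamma> @ [\<beta>] @ \<Delta> \<turnstile> \<gamma>} (\<Gamma> @ \<Pi> @ [\<alpha> \<rightharpoondown> \<beta>] @ \<Delta> \<turnstile> \<gamma>)"
| ldivR: "malc {[\<alpha>] @ \<Pi> \<turnstile> \<beta>} (\<Pi> \<turnstile> \<alpha> \<rightharpoondown> \<beta>)"
| rdivL: "malc {\<Pi> \<turnstile> \<alpha>, \<Gamma> @ [\<beta>] @ \<Delta> \<turnstile> \<gamma>} (\<Gamma> @ [\<beta> \<leftharpoondown> \<alpha>] @ \<Pi> @ \<Delta> \<turnstile> \<gamma>)"
| rdivR: "malc {\<Pi> @ [\<alpha>] \<turnstile> \<beta>} (\<Pi> \<turnstile> \<beta> \<leftharpoondown> \<alpha>)"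
| prodL: "malc {\<Gamma> @ [\<alpha>, \<beta>] @ \<Delta> \<turnstile> \<gamma>} (\<Gamma> @ [\<alpha> \<bullet> \<beta>] @ \<Delta> \<turnstile> \<gamma>)"
| prodR: "malc {\<Gamma> \<turnstile> \<alpha>, \<Delta> \<turnstile> \<beta>} (\<Gamma> @ \<Delta> \<turnstile> \<alpha> \<bullet> \<beta>)"
| conjL1: "malc {\<Gamma> @ [\<alpha>] @ \<Delta> \<turnstile> \<gamma>} (\<Gamma> @ [\<alpha> \<sqinter> \<beta>] @ \<Delta> \<turnstile> \<gamma>)"
| conjL2: "malc {\<Gamma> @ [\<beta>] @ \<Delta> \<turnstile> \<gamma>} (\<Gamma> @ [\<alpha> \<sqinter> \<beta>] @ \<Delta> \<turnstile> \<gamma>)"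
| conjR: "malc {\<Pi> \<turnstile> \<alpha>, \<Pi> \<turnstile> \<beta>} (\<Pi> \<turnstile> \<alpha> \<sqinter> \<beta>)"
| disjL: "malc {\<Gamma> @ [\<alpha>] @ \<Delta> \<turnstile> \<gamma>, \<Gamma> @ [\<beta>] @ \<Delta> \<turnstile> \<gamma>} (\<Gamma> @ [\<alpha> \<squnion> \<beta>] @ \<Delta> \<turnstile> \<gamma>)"
| disjR1: "malc {\<Pi> \<turnstile> \<alpha>} (\<Pi> \<turnstile> \<alpha> \<squnion> \<beta>)"
| disjR2: "malc {\<Pi> \<turnstile> \<beta>} (\<Pi> \<turnstile> \<alpha> \<squnion> \<beta>)"

inductive cut :: rules where
  cut: "cut {\<Pi> \<turnstile> \<alpha>, \<Gamma> @ [\<alpha>] @ \<Delta> \<turnstile> \<gamma>} (\<Gamma> @ \<Pi> @ \<Delta> \<turnstile> \<gamma>)"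

inductive star_ind :: rules where
  starL: "star_ind {[] \<turnstile> \<beta>, [\<alpha>, \<beta>] \<turnstile> \<beta>} ([Star \<alpha>] \<turnstile> \<beta>)"
| starR0: "star_ind {} ([] \<turnstile> Star \<alpha>)"
| starR: "star_ind {\<Pi> \<turnstile> \<alpha>, \<Delta> \<turnstile> Star \<alpha>} (\<Pi> @ \<Delta> \<turnstile> Star \<alpha>)"

inductive star_omega :: rules where
  omegaL: "star_omega {\<Gamma> @ replicate n \<alpha> @ \<Delta> \<turnstile> \<gamma> | n. True} (\<Gamma> @ [Star \<alpha>] @ \<Delta> \<turnstile> \<gamma>)"
| omegaR: "star_omega {\<Pi> \<turnstile> \<alpha> | \<Pi>. \<Pi> \<in> set \<Pi>s} (concat \<Pi>s \<turnstile> Star \<alpha>)"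

inductive distr :: rules where
  distr: "distr {} ([(\<alpha> \<squnion> \<beta>) \<sqinter> (\<alpha> \<squnion> \<gamma>)] \<turnstile> \<alpha> \<squnion> (\<beta> \<sqinter> \<gamma>))"

definition ACT :: "sequent set" where
  "ACT = {s. derivable (\<lambda>P s. malc P s \<or> star_ind P s \<or> cut P s) s}"

definition ACT_omega_D :: "sequent set" where
  "ACT_omega_D = {s. derivable (\<lambda>P s. malc P s \<or> star_omega P s \<or> distr P s \<or> cut P s) s}"

(* Kleene's partial recursive functions. Pr f g recurses on the first argument:
   h(0,xs) = f(xs) and h(n+1,xs) = g(n,h(n,xs),xs). Mn f xs is the least n with
   f(n,xs) = 0, where f(m,xs) has to be defined for all m < n. *)
datatype recf = Z | S | Id nat | Cn recf "recf list" | Pr recf recf | Mn recf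

(* eval f xs y: the function denoted by f is defined on xs and has value y. *)
inductive eval :: "recf \<Rightarrow> nat list \<Rightarrow> nat \<Rightarrow> bool" where
  "eval Z xs 0"
| "eval S (x # xs) (Suc x)"
| "i < length xs \<Longrightarrow> eval (Id i) xs (xs ! i)"
| "list_all2 (\<lambda>g y. eval g xs y) gs ys \<Longrightarrow> eval f ys z \<Longrightarrow> eval (Cn f gs) xs z"
| "eval f xs y \<Longrightarrow> eval (Pr f g) (0 # xs) y"
| "eval (Pr f g) (n # xs) r \<Longrightarrow> eval g (n # r # xs) y \<Longrightarrow> eval (Pr f g) (Suc n # xs) y"
| "eval f (n # xs) 0 \<Longrightarrow> (\<And>m. m < n \<Longrightarrow> \<exists>k. eval f (m # xs) (Suc k)) \<Longrightarrow> eval (Mn f) xs n"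

inductive_cases eval_ZE: "eval Z xs y"
inductive_cases eval_SE: "eval S xs y"
inductive_cases eval_IdE: "eval (Id i) xs y"
inductive_cases eval_CnE: "eval (Cn f gs) xs y"
inductive_cases eval_Pr0E: "eval (Pr f g) (0 # xs) y"
inductive_cases eval_PrSucE: "eval (Pr f g) (Suc n # xs) y"
inductive_cases eval_MnE: "eval (Mn f) xs y"

lemma eval_deterministic: "eval f xs y \<Longrightarrow> eval f xs y' \<Longrightarrow> y = y'"
proof (induction arbitrary: y' rule: eval.induct)
  case (4 xs gs ys f z)
  from "4.prems" obtain ys' where ys': "list_all2 (\<lambda>g y. eval g xs y) gs ys'" "eval f ys' y'"
    by (rule eval_CnE)
  have "ys = ys'"
    using list_all2_lengthD[OF "4.IH"(1)] list_all2_lengthD[OF ys'(1)]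
      list_all2_nthD[OF "4.IH"(1)] list_all2_nthD[OF ys'(1)]
    by (intro nth_equalityI) auto
  then show ?case using "4.IH"(2) ys'(2) by blast
next
  case (6 f g n xs r y)
  from "6.prems" obtain r' where "eval (Pr f g) (n # xs) r'" "eval g (n # r' # xs) y'"
    by (rule eval_PrSucE)
  then show ?case using "6.IH" by blast
next
  case (7 f n xs)
  from "7.prems" have y': "eval f (y' # xs) 0" "\<And>m. m < y' \<Longrightarrow> \<exists>k. eval f (m # xs) (Suc k)"
    by (auto elim: eval_MnE)
  show ?case
  proof (rule linorder_cases[of n y'])
    assume "n < y'"
    then show ?thesis using y'(2) "7.IH"(1) by (metis nat.distinct(1))
  next
    assume "y' < n"
    then show ?thesis using y'(1) "7.IH"(2) by (metis nat.distinct(1))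
  qed
qed (blast elim: eval_ZE eval_SE eval_IdE eval_Pr0E)+

definition computable :: "(nat \<Rightarrow> nat) \<Rightarrow> bool" where
  "computable h \<longleftrightarrow> (\<exists>f. \<forall>x. eval f [x] (h x))"

definition decidable :: "nat set \<Rightarrow> bool" where
  "decidable A \<longleftrightarrow> computable (\<lambda>x. if x \<in> A then 1 else 0)"

definition r_e :: "nat set \<Rightarrow> bool" where
  "r_e A \<longleftrightarrow> (\<exists>f. \<forall>x. x \<in> A \<longleftrightarrow> (\<exists>y. eval f [x] y))"

definition many_one_reducible :: "nat set \<Rightarrow> nat set \<Rightarrow> bool" (infix "\<le>\<^sub>m" 50) where
  "A \<le>\<^sub>m B \<longleftrightarrow> (\<exists>h. computable h \<and> (\<forall>x. x \<in> A \<longleftrightarrow> h x \<in> B))"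

definition Sigma1_complete :: "nat set \<Rightarrow> bool" where
  "Sigma1_complete B \<longleftrightarrow> r_e B \<and> (\<forall>A. r_e A \<longrightarrow> A \<le>\<^sub>m B)"

fun form_code :: "form \<Rightarrow> nat" where
  "form_code (Var n) = prod_encode (0, n)"
| "form_code Zero = prod_encode (1, 0)"
| "form_code One = prod_encode (2, 0)"
| "form_code (\<alpha> \<bullet> \<beta>) = prod_encode (3, prod_encode (form_code \<alpha>, form_code \<beta>))"
| "form_code (\<alpha> \<rightharpoondown> \<beta>) = prod_encode (4, prod_encode (form_code \<alpha>, form_code \<beta>))"
| "form_code (\<alpha> \<leftharpoondown> \<beta>) = prod_encode (5, prod_encode (form_code \<alpha>, form_code \<beta>))"
| "form_code (\<alpha> \<squnion> \<beta>) = prod_encode (6, prod_encode (form_code \<alpha>, form_code \<beta>))"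
| "form_code (\<alpha> \<sqinter> \<beta>) = prod_encode (7, prod_encode (form_code \<alpha>, form_code \<beta>))"
| "form_code (Star \<alpha>) = prod_encode (8, form_code \<alpha>)"

fun seq_code :: "sequent \<Rightarrow> nat" where
  "seq_code (\<Gamma> \<turnstile> \<beta>) = prod_encode (list_encode (map form_code \<Gamma>), form_code \<beta>)"

lemma form_code_inject: "form_code \<alpha> = form_code \<beta> \<Longrightarrow> \<alpha> = \<beta>"
proof (induction \<alpha> arbitrary: \<beta>)
  case Var
  then show ?case by (cases \<beta>) auto
next
  case Zero
  then show ?case by (cases \<beta>) auto
next
  case One
  then show ?case by (cases \<beta>) auto
next
  case Prod
  then show ?case by (cases \<beta>) auto
next
  case LDiv
  then show ?case by (cases \<beta>) auto
next
  case RDiv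
  then show ?case by (cases \<beta>) auto
next
  case Disj
  then show ?case by (cases \<beta>) auto
next
  case Conj
  then show ?case by (cases \<beta>) auto
next
  case Star
  then show ?case by (cases \<beta>) auto
qed

lemma inj_form_code: "inj form_code"
  using form_code_inject by (rule injI)

lemma inj_seq_code: "inj seq_code"
proof (rule injI)
  show "s = t" if "seq_code s = seq_code t" for s t
    using that inj_form_code
    by (cases s; cases t) (auto simp: list_encode_eq inj_map_eq_map dest: form_code_inject)
qed

(* The range of seq_code is decidable, so passing to codes neither creates nor destroys
   decidability or recursive enumerability. *)
definition decidable_logic :: "sequent set \<Rightarrow> bool" where
  "decidable_logic L \<longleftrightarrow> decidable (seq_code ` L)"

definition r_e_logic :: "sequent set \<Rightarrow> bool" where
  "r_e_logic L \<longleftrightarrow> r_e (seq_code ` L)"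

definition Sigma1_complete_logic :: "sequent set \<Rightarrow> bool" where
  "Sigma1_complete_logic L \<longleftrightarrow> Sigma1_complete (seq_code ` L)"

end

theory Submission
  imports Defs
begin

text \<open>
  A machine with finitely many registers, whose instructions increment or decrement, has as its
  history a word: each executed instruction contributes its label followed by the value written, in
  unary. Every violation of correctness is local: the value written by an instruction disagrees with
  the last value of its source register, or a label is not the successor prescribed by the preceding
  entry. The words with such a violation form a context-free language, which is coded in Lambek
  style: the letters become formulae and the grammar becomes a goal built from products, joins
  and stars. The query for an input asserts that any word over the alphabet that follows the
  initial history and ends with the rejecting label contains a violation.

  If the machine accepts, any word either deviates from the history after boundedly many letters
  or reaches the accepting label, so unfolding the star finitely often proves the query in action
  logic. If the machine rejects, its history is a counterexample in the algebra of languages over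
  the free monoid, which is a distributive model of infinitary action logic.

  Given recursive enumerations of a set \<open>A\<close> and of the logic, let the machine search for \<open>z\<close> in \<open>A\<close>, in
  which case it accepts, and for its own query on \<open>z\<close> in the logic, in which case it rejects. Then the
  query belongs to the logic if and only if \<open>z\<close> is in \<open>A\<close>. Self-reference needs no recursion theorem:
  the codes of the formulae of the query are part of the input.
\<close>

section \<open>Language models of infinitary action logic\<close>

text \<open>The logic is known only to lie between two sets, so the query is controlled only where
  exactly one of the two searches halts; nothing is claimed when both halt or neither does. This is
  enough. If \<open>z\<close> is in \<open>A\<close> but the query is not in the logic, only the
  accepting search halts, which puts the query into \<open>ACT\<close>; if the query is in the logic
  but \<open>z\<close> is not in \<open>A\<close>, only the rejecting search halts, which keeps it
  out of \<open>ACT_omega_D\<close>. For undecidability, the two searches wait for the two answers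
  of a decision procedure on the machine's own query. Since \<open>ACT\<close> has no omega-rule,
  the star over all words can be unfolded only finitely often. Violations therefore have to show at
  the first wrong letter: then every letter but one closes its branch at once, and as the machine is
  deterministic, the only surviving branch follows the run. Comparing a value with its source needs
  equal numbers of ticks on two sides of a label, which stars of letters cannot express. Divisions
  inside the letter formulae generate such words, one division per production, while the goal has no
  divisions, so that membership of a word in its language yields a derivation.\<close>

definition conc :: "'a list set \<Rightarrow> 'a list set \<Rightarrow> 'a list set" where
  "conc A B = {u @ v | u v. u \<in> A \<and> v \<in> B}"

primrec lang :: "(nat \<Rightarrow> 'a list set) \<Rightarrow> form \<Rightarrow> 'a list set" where
  "lang V (Var n) = V n"
| "lang V Zero = {}"
| "lang V One = {[]}"
| "lang V (\<alpha> \<bullet> \<beta>) = conc (lang V \<alpha>) (lang V \<beta>)"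
| "lang V (\<alpha> \<rightharpoondown> \<beta>) = {w. \<forall>u\<in>lang V \<alpha>. u @ w \<in> lang V \<beta>}"
| "lang V (\<beta> \<leftharpoondown> \<alpha>) = {w. \<forall>u\<in>lang V \<alpha>. w @ u \<in> lang V \<beta>}"
| "lang V (\<alpha> \<squnion> \<beta>) = lang V \<alpha> \<union> lang V \<beta>"
| "lang V (\<alpha> \<sqinter> \<beta>) = lang V \<alpha> \<inter> lang V \<beta>"
| "lang V (Star \<alpha>) = {concat ws | ws. set ws \<subseteq> lang V \<alpha>}"

primrec langs :: "(nat \<Rightarrow> 'a list set) \<Rightarrow> form list \<Rightarrow> 'a list set" where
  "langs V [] = {[]}"
| "langs V (\<alpha> # \<Gamma>) = conc (lang V \<alpha>) (langs V \<Gamma>)"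

fun valid :: "(nat \<Rightarrow> 'a list set) \<Rightarrow> sequent \<Rightarrow> bool" where
  "valid V (\<Gamma> \<turnstile> \<beta>) \<longleftrightarrow> langs V \<Gamma> \<subseteq> lang V \<beta>"

lemma concI: "u \<in> A \<Longrightarrow> v \<in> B \<Longrightarrow> u @ v \<in> conc A B"
  by (auto simp: conc_def)

lemma concE:
  assumes "w \<in> conc A B"
  obtains u v where "w = u @ v" "u \<in> A" "v \<in> B"
  using assms by (auto simp: conc_def)

lemma conc_assoc: "conc (conc A B) C = conc A (conc B C)"
proof (intro equalityI subsetI)
  fix w assume "w \<in> conc (conc A B) C"
  then obtain a b c where "w = a @ b @ c" "a \<in> A" "b \<in> B" "c \<in> C"
    by (auto elim!: concE)
  then show "w \<in> conc A (conc B C)" by (simp add: concI)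
next
  fix w assume "w \<in> conc A (conc B C)"
  then obtain a b c where "w = (a @ b) @ c" "a \<in> A" "b \<in> B" "c \<in> C"
    by (auto elim!: concE)
  then show "w \<in> conc (conc A B) C" by (blast intro: concI)
qed

lemma conc_Nil [simp]: "conc {[]} A = A" "conc A {[]} = A"
  by (auto simp: conc_def)

lemma conc_empty [simp]: "conc {} A = {}" "conc A {} = {}"
  by (auto simp: conc_def)

lemma conc_mono: "A \<subseteq> A' \<Longrightarrow> B \<subseteq> B' \<Longrightarrow> conc A B \<subseteq> conc A' B'"
  by (auto simp: conc_def)

lemma conc_Un: "conc (A \<union> B) C = conc A C \<union> conc B C" "conc C (A \<union> B) = conc C A \<union> conc C B"
  by (auto simp: conc_def)

lemma langs_append [simp]: "langs V (\<Gamma> @ \<Delta>) = conc (langs V \<Gamma>) (langs V \<Delta>)"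
  by (induction \<Gamma>) (simp_all add: conc_assoc)

lemma langs_concat:
  assumes "\<And>\<Pi>. \<Pi> \<in> set \<Pi>s \<Longrightarrow> langs V \<Pi> \<subseteq> lang V \<alpha>"
  shows "langs V (concat \<Pi>s) \<subseteq> lang V (Star \<alpha>)"
  using assms
proof (induction \<Pi>s)
  case Nil
  then show ?case by (auto intro!: exI[of _ "[]"])
next
  case (Cons \<Pi> \<Pi>s)
  show ?case
  proof
    fix w assume "w \<in> langs V (concat (\<Pi> # \<Pi>s))"
    then obtain u v where w: "w = u @ v" "u \<in> langs V \<Pi>" "v \<in> langs V (concat \<Pi>s)"
      by (auto elim: concE)
    moreover have "langs V (concat \<Pi>s) \<subseteq> lang V (Star \<alpha>)"
      using Cons by simp
    ultimately obtain ws where "v = concat ws" "set ws \<subseteq> lang V \<alpha>"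
      by auto
    then have "w = concat (u # ws) \<and> set (u # ws) \<subseteq> lang V \<alpha>"
      using w Cons.prems[of \<Pi>] by auto
    then show "w \<in> lang V (Star \<alpha>)"
      unfolding lang.simps by blast
  qed
qed

lemma concat_in_langs_replicate:
  "set ws \<subseteq> lang V \<alpha> \<Longrightarrow> concat ws \<in> langs V (replicate (length ws) \<alpha>)"
  by (induction ws) (auto intro: concI)

text \<open>A given word uses a definite number of factors of the star, so a single premise of the
  omega-rule settles it.\<close>

lemma valid_Star_left:
  assumes "\<And>n. valid V (\<Gamma> @ replicate n \<alpha> @ \<Delta> \<turnstile> \<gamma>)"
  shows "valid V (\<Gamma> @ [Star \<alpha>] @ \<Delta> \<turnstile> \<gamma>)"
  unfolding valid.simps
proof
  fix w assume "w \<in> langs V (\<Gamma> @ [Star \<alpha>] @ \<Delta>)"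
  then obtain u v ws where "w = u @ concat ws @ v" "u \<in> langs V \<Gamma>" "v \<in> langs V \<Delta>"
    "set ws \<subseteq> lang V \<alpha>"
    by (auto simp: conc_def)
  then have "w \<in> langs V (\<Gamma> @ replicate (length ws) \<alpha> @ \<Delta>)"
    by (auto intro!: concI concat_in_langs_replicate)
  then show "w \<in> lang V \<gamma>"
    using assms[of "length ws"] by auto
qed

lemma conc_ldiv: "conc P (conc {w. \<forall>u\<in>A. u @ w \<in> B} D) \<subseteq> conc B D" if "P \<subseteq> A"
proof
  fix w assume "w \<in> conc P (conc {w. \<forall>u\<in>A. u @ w \<in> B} D)"
  then obtain u x v where "w = (u @ x) @ v" "u \<in> P" "\<forall>u\<in>A. u @ x \<in> B" "v \<in> D"
    by (auto simp: conc_def)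
  then show "w \<in> conc B D" using that by (blast intro: concI)
qed

lemma conc_rdiv: "conc {w. \<forall>u\<in>A. w @ u \<in> B} (conc P D) \<subseteq> conc B D" if "P \<subseteq> A"
proof
  fix w assume "w \<in> conc {w. \<forall>u\<in>A. w @ u \<in> B} (conc P D)"
  then obtain u x v where "w = (x @ u) @ v" "u \<in> P" "\<forall>u\<in>A. x @ u \<in> B" "v \<in> D"
    by (auto simp: conc_def)
  then show "w \<in> conc B D" using that by (blast intro: concI)
qed

lemma malc_valid:
  assumes "malc P s" "\<forall>p\<in>P. valid V p"
  shows "valid V s"
  using assms
proof (induction rule: malc.induct)
  case (ldivL \<Pi> \<alpha> \<Gamma> \<beta> \<Delta> \<gamma>)
  then have "langs V \<Pi> \<subseteq> lang V \<alpha>" "conc (langs V \<Gamma>) (conc (lang V \<beta>) (langs V \<Delta>)) \<subseteq> lang V \<gamma>"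
    by auto
  then show ?case
    using conc_mono[OF order_refl conc_ldiv, of "langs V \<Pi>" "lang V \<alpha>" "langs V \<Gamma>" "lang V \<beta>" "langs V \<Delta>"]
    by auto
next
  case (rdivL \<Pi> \<alpha> \<Gamma> \<beta> \<Delta> \<gamma>)
  then have "langs V \<Pi> \<subseteq> lang V \<alpha>" "conc (langs V \<Gamma>) (conc (lang V \<beta>) (langs V \<Delta>)) \<subseteq> lang V \<gamma>"
    by auto
  then show ?case
    using conc_mono[OF order_refl conc_rdiv, of "langs V \<Pi>" "lang V \<alpha>" "langs V \<Gamma>" "lang V \<beta>" "langs V \<Delta>"]
    by auto
next
  case (prodR \<Gamma> \<alpha> \<Delta> \<beta>)
  then show ?case by (simp add: conc_mono)
next
  case (conjL1 \<Gamma> \<alpha> \<Delta> \<gamma> \<beta>)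
  moreover have "conc (langs V \<Gamma>) (conc (lang V \<alpha> \<inter> lang V \<beta>) (langs V \<Delta>))
      \<subseteq> conc (langs V \<Gamma>) (conc (lang V \<alpha>) (langs V \<Delta>))"
    by (intro conc_mono) auto
  ultimately show ?case by auto
next
  case (conjL2 \<Gamma> \<beta> \<Delta> \<gamma> \<alpha>)
  moreover have "conc (langs V \<Gamma>) (conc (lang V \<alpha> \<inter> lang V \<beta>) (langs V \<Delta>))
      \<subseteq> conc (langs V \<Gamma>) (conc (lang V \<beta>) (langs V \<Delta>))"
    by (intro conc_mono) auto
  ultimately show ?case by auto
next
  case (ldivR \<alpha> \<Pi> \<beta>)
  then show ?case by (auto intro: concI)
next
  case (rdivR \<alpha> \<Pi> \<beta>)
  then show ?case by (auto intro: concI)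
qed (auto simp: conc_assoc conc_Un)

lemma cut_valid:
  assumes "cut P s" "\<forall>p\<in>P. valid V p"
  shows "valid V s"
  using assms
proof (induction rule: cut.induct)
  case (cut \<Pi> \<alpha> \<Gamma> \<Delta> \<gamma>)
  then have "langs V \<Pi> \<subseteq> lang V \<alpha>" "conc (langs V \<Gamma>) (conc (lang V \<alpha>) (langs V \<Delta>)) \<subseteq> lang V \<gamma>"
    by auto
  then show ?case
    using conc_mono[OF order_refl conc_mono[OF _ order_refl], of "langs V \<Pi>" "lang V \<alpha>" "langs V \<Gamma>" "langs V \<Delta>"]
    by auto
qed

lemma star_omega_valid:
  assumes "star_omega P s" "\<forall>p\<in>P. valid V p"
  shows "valid V s"
  using assms
proof (induction rule: star_omega.induct)
  case (omegaL \<Gamma> \<alpha> \<Delta> \<gamma>)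
  then show ?case by (intro valid_Star_left) blast
next
  case (omegaR \<alpha> \<Pi>s)
  then have "\<And>\<Pi>. \<Pi> \<in> set \<Pi>s \<Longrightarrow> langs V \<Pi> \<subseteq> lang V \<alpha>" by force
  then show ?case using langs_concat[of \<Pi>s V \<alpha>] by simp
qed

text \<open>Joins and meets are unions and intersections of sets, hence distributive; this is what
  admits \<open>distr\<close> in the upper bound.\<close>

lemma distr_valid: "distr P s \<Longrightarrow> valid V s"
  by (induction rule: distr.induct) auto

theorem ACT_omega_D_valid:
  assumes "s \<in> ACT_omega_D"
  shows "valid V s"
proof -
  have "derivable (\<lambda>P s. malc P s \<or> star_omega P s \<or> distr P s \<or> cut P s) s"
    using assms by (simp add: ACT_omega_D_def)
  then show ?thesis
  proof (induction rule: derivable.induct)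
    case (step P s)
    then show ?case
      using malc_valid star_omega_valid distr_valid cut_valid by metis
  qed
qed

section \<open>Derivations in action logic\<close>

definition act :: "form list \<Rightarrow> form \<Rightarrow> bool" (infix "\<tturnstile>" 55) where
  "\<Gamma> \<tturnstile> \<beta> \<longleftrightarrow> (\<Gamma> \<turnstile> \<beta>) \<in> ACT"

lemma act_step:
  assumes "malc P (\<Gamma> \<turnstile> \<beta>) \<or> star_ind P (\<Gamma> \<turnstile> \<beta>) \<or> cut P (\<Gamma> \<turnstile> \<beta>)"
    and "\<And>\<Pi> \<alpha>. (\<Pi> \<turnstile> \<alpha>) \<in> P \<Longrightarrow> \<Pi> \<tturnstile> \<alpha>"
  shows "\<Gamma> \<tturnstile> \<beta>"
  unfolding act_def ACT_def mem_Collect_eq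
proof (rule derivable.step)
  show "malc P (\<Gamma> \<turnstile> \<beta>) \<or> star_ind P (\<Gamma> \<turnstile> \<beta>) \<or> cut P (\<Gamma> \<turnstile> \<beta>)" by (rule assms)
next
  fix p assume "p \<in> P"
  then show "derivable (\<lambda>P s. malc P s \<or> star_ind P s \<or> cut P s) p"
    using assms(2) by (cases p) (auto simp: act_def ACT_def)
qed

lemma act_ax: "[\<alpha>] \<tturnstile> \<alpha>"
  by (rule act_step[OF disjI1[OF malc.ax]]) auto

lemma act_oneR: "[] \<tturnstile> One"
  by (rule act_step[OF disjI1[OF malc.oneR]]) auto

lemma act_oneL: "\<Gamma> @ \<Delta> \<tturnstile> \<gamma> \<Longrightarrow> \<Gamma> @ One # \<Delta> \<tturnstile> \<gamma>"
  using act_step[OF disjI1[OF malc.oneL]] by auto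

lemma act_ldivL: "\<Pi> \<tturnstile> \<alpha> \<Longrightarrow> \<Pi> @ [\<alpha> \<rightharpoondown> \<beta>] \<tturnstile> \<beta>"
  using act_step[OF disjI1[OF malc.ldivL[of \<Pi> \<alpha> "[]" \<beta> "[]" \<beta>]]] act_ax by auto

lemma act_rdivL: "\<Pi> \<tturnstile> \<alpha> \<Longrightarrow> (\<beta> \<leftharpoondown> \<alpha>) # \<Pi> \<tturnstile> \<beta>"
  using act_step[OF disjI1[OF malc.rdivL[of \<Pi> \<alpha> "[]" \<beta> "[]" \<beta>]]] act_ax by auto

lemma act_prodL: "\<Gamma> @ \<alpha> # \<beta> # \<Delta> \<tturnstile> \<gamma> \<Longrightarrow> \<Gamma> @ (\<alpha> \<bullet> \<beta>) # \<Delta> \<tturnstile> \<gamma>"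
  using act_step[OF disjI1[OF malc.prodL]] by auto

lemma act_prodR: "\<Gamma> \<tturnstile> \<alpha> \<Longrightarrow> \<Delta> \<tturnstile> \<beta> \<Longrightarrow> \<Gamma> @ \<Delta> \<tturnstile> \<alpha> \<bullet> \<beta>"
  by (rule act_step[OF disjI1[OF malc.prodR[of \<Gamma> \<alpha> \<Delta> \<beta>]]]) auto

lemma act_conjL1: "\<Gamma> @ \<alpha> # \<Delta> \<tturnstile> \<gamma> \<Longrightarrow> \<Gamma> @ (\<alpha> \<sqinter> \<beta>) # \<Delta> \<tturnstile> \<gamma>"
  using act_step[OF disjI1[OF malc.conjL1]] by auto

lemma act_conjL2: "\<Gamma> @ \<beta> # \<Delta> \<tturnstile> \<gamma> \<Longrightarrow> \<Gamma> @ (\<alpha> \<sqinter> \<beta>) # \<Delta> \<tturnstile> \<gamma>"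
  using act_step[OF disjI1[OF malc.conjL2]] by auto

lemma act_disjL: "\<Gamma> @ \<alpha> # \<Delta> \<tturnstile> \<gamma> \<Longrightarrow> \<Gamma> @ \<beta> # \<Delta> \<tturnstile> \<gamma> \<Longrightarrow> \<Gamma> @ (\<alpha> \<squnion> \<beta>) # \<Delta> \<tturnstile> \<gamma>"
  using act_step[OF disjI1[OF malc.disjL[of \<Gamma> \<alpha> \<Delta> \<gamma> \<beta>]]] by auto

lemma act_disjR1: "\<Pi> \<tturnstile> \<alpha> \<Longrightarrow> \<Pi> \<tturnstile> \<alpha> \<squnion> \<beta>"
  by (rule act_step[OF disjI1[OF malc.disjR1[of \<Pi> \<alpha> \<beta>]]]) auto

lemma act_disjR2: "\<Pi> \<tturnstile> \<beta> \<Longrightarrow> \<Pi> \<tturnstile> \<alpha> \<squnion> \<beta>"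
  by (rule act_step[OF disjI1[OF malc.disjR2[of \<Pi> \<beta> \<alpha>]]]) auto

lemma act_zeroL: "\<Gamma> @ Zero # \<Delta> \<tturnstile> \<gamma>"
  using act_step[OF disjI1[OF malc.zeroL[of \<Gamma> \<Delta> \<gamma>]]] by auto

lemma act_cut: "\<Pi> \<tturnstile> \<alpha> \<Longrightarrow> \<Gamma> @ \<alpha> # \<Delta> \<tturnstile> \<gamma> \<Longrightarrow> \<Gamma> @ \<Pi> @ \<Delta> \<tturnstile> \<gamma>"
  by (rule act_step[OF disjI2[OF disjI2[OF cut.cut[of \<Pi> \<alpha> \<Gamma> \<Delta> \<gamma>]]]]) auto

lemma act_starL: "[] \<tturnstile> \<beta> \<Longrightarrow> [\<alpha>, \<beta>] \<tturnstile> \<beta> \<Longrightarrow> [Star \<alpha>] \<tturnstile> \<beta>"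
  by (rule act_step[OF disjI2[OF disjI1[OF star_ind.starL[of \<beta> \<alpha>]]]]) auto

lemma act_starR0: "[] \<tturnstile> Star \<alpha>"
  by (rule act_step[OF disjI2[OF disjI1[OF star_ind.starR0[of \<alpha>]]]]) auto

lemma act_starR: "\<Pi> \<tturnstile> \<alpha> \<Longrightarrow> \<Delta> \<tturnstile> Star \<alpha> \<Longrightarrow> \<Pi> @ \<Delta> \<tturnstile> Star \<alpha>"
  by (rule act_step[OF disjI2[OF disjI1[OF star_ind.starR[of \<Pi> \<alpha> \<Delta>]]]]) auto

text \<open>The induction rule, applied to
  \<open>One \<squnion> (\<alpha> \<bullet> Star \<alpha>)\<close>, shows that the star entails its
  own unfolding; a cut then replaces the star by the two cases. This is the finite substitute for
  the omega-rule.\<close>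

lemma act_star_unfold:
  assumes "\<Gamma> @ \<Delta> \<tturnstile> \<gamma>" and "\<Gamma> @ \<alpha> # Star \<alpha> # \<Delta> \<tturnstile> \<gamma>"
  shows "\<Gamma> @ Star \<alpha> # \<Delta> \<tturnstile> \<gamma>"
proof -
  let ?\<beta> = "One \<squnion> (\<alpha> \<bullet> Star \<alpha>)"
  have "[\<alpha>] @ [] \<tturnstile> \<alpha> \<bullet> Star \<alpha>"
    by (intro act_prodR act_ax act_starR0)
  then have "[\<alpha>] @ One # [] \<tturnstile> ?\<beta>"
    by (intro act_oneL act_disjR2)
  moreover have "[\<alpha>] @ [\<alpha>, Star \<alpha>] \<tturnstile> \<alpha> \<bullet> Star \<alpha>"
    using act_starR[OF act_ax act_ax] by (intro act_prodR act_ax) auto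
  then have "[\<alpha>] @ (\<alpha> \<bullet> Star \<alpha>) # [] \<tturnstile> ?\<beta>"
    by (intro act_prodL act_disjR2)
  ultimately have "[\<alpha>] @ ?\<beta> # [] \<tturnstile> ?\<beta>"
    by (rule act_disjL)
  then have "[Star \<alpha>] \<tturnstile> ?\<beta>"
    by (intro act_starL act_disjR1[OF act_oneR]) simp
  moreover have "\<Gamma> @ ?\<beta> # \<Delta> \<tturnstile> \<gamma>"
    using assms by (intro act_disjL act_oneL act_prodL)
  ultimately have "\<Gamma> @ [Star \<alpha>] @ \<Delta> \<tturnstile> \<gamma>"
    by (rule act_cut)
  then show ?thesis by simp
qed

lemma act_star_mono:
  assumes "[\<alpha>] \<tturnstile> \<beta>"
  shows "[Star \<alpha>] \<tturnstile> Star \<beta>"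
  using act_starR[OF assms act_ax] by (intro act_starL act_starR0) simp

abbreviation bigdisj :: "form list \<Rightarrow> form" where
  "bigdisj \<alpha>s \<equiv> foldr Disj \<alpha>s Zero"

lemma lang_bigdisj [simp]: "lang V (bigdisj \<alpha>s) = (\<Union>\<alpha>\<in>set \<alpha>s. lang V \<alpha>)"
  by (induction \<alpha>s) auto

lemma act_bigdisjL: "(\<And>\<alpha>. \<alpha> \<in> set \<alpha>s \<Longrightarrow> \<Gamma> @ \<alpha> # \<Delta> \<tturnstile> \<gamma>) \<Longrightarrow> \<Gamma> @ bigdisj \<alpha>s # \<Delta> \<tturnstile> \<gamma>"
  by (induction \<alpha>s) (auto intro: act_zeroL act_disjL)

abbreviation bigconj :: "form list \<Rightarrow> form \<Rightarrow> form" where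
  "bigconj \<alpha>s \<beta> \<equiv> foldr Conj \<alpha>s \<beta>"

lemma lang_bigconj [simp]: "lang V (bigconj \<alpha>s \<beta>) = (\<Inter>\<alpha>\<in>set \<alpha>s. lang V \<alpha>) \<inter> lang V \<beta>"
  by (induction \<alpha>s) auto

lemma act_bigconjL:
  "\<alpha> \<in> insert \<beta> (set \<alpha>s) \<Longrightarrow> \<Gamma> @ \<alpha> # \<Delta> \<tturnstile> \<gamma> \<Longrightarrow> \<Gamma> @ bigconj \<alpha>s \<beta> # \<Delta> \<tturnstile> \<gamma>"
proof (induction \<alpha>s)
  case (Cons a \<alpha>s)
  then show ?case
    by (cases "\<alpha> = a") (auto intro: act_conjL1 act_conjL2)
qed simp

fun positive :: "form \<Rightarrow> bool" where
  "positive (\<alpha> \<bullet> \<beta>) \<longleftrightarrow> positive \<alpha> \<and> positive \<beta>"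
| "positive (\<alpha> \<squnion> \<beta>) \<longleftrightarrow> positive \<alpha> \<and> positive \<beta>"
| "positive (Star \<alpha>) \<longleftrightarrow> positive \<alpha>"
| "positive (\<alpha> \<rightharpoondown> \<beta>) \<longleftrightarrow> False"
| "positive (\<beta> \<leftharpoondown> \<alpha>) \<longleftrightarrow> False"
| "positive (\<alpha> \<sqinter> \<beta>) \<longleftrightarrow> False"
| "positive _ \<longleftrightarrow> True"

lemma positive_bigdisj [simp]: "positive (bigdisj \<alpha>s) \<longleftrightarrow> (\<forall>\<alpha>\<in>set \<alpha>s. positive \<alpha>)"
  by (induction \<alpha>s) auto

text \<open>For these connectives membership supplies a splitting of the word or a choice of a
  joinand, which is exactly what the right rules ask for. Membership in a division quantifies over
  all words instead and gives no derivation.\<close>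

lemma act_positive:
  assumes "\<And>n w. w \<in> V n \<Longrightarrow> map f w \<tturnstile> Var n"
    and "positive \<alpha>" "w \<in> lang V \<alpha>"
  shows "map f w \<tturnstile> \<alpha>"
  using assms(2,3)
proof (induction \<alpha> arbitrary: w)
  case (Prod \<alpha> \<beta>)
  then obtain u v where "w = u @ v" "u \<in> lang V \<alpha>" "v \<in> lang V \<beta>"
    by (auto elim: concE)
  then show ?case
    using Prod act_prodR[of "map f u" \<alpha> "map f v" \<beta>] by simp
next
  case (Disj \<alpha> \<beta>)
  then show ?case by (auto intro: act_disjR1 act_disjR2)
next
  case (Star \<alpha>)
  then obtain ws where "w = concat ws" "set ws \<subseteq> lang V \<alpha>" by auto
  moreover have "set ws \<subseteq> lang V \<alpha> \<Longrightarrow> map f (concat ws) \<tturnstile> Star \<alpha>"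
    using Star by (induction ws) (auto intro: act_starR0 act_starR)
  ultimately show ?case by simp
qed (auto intro: assms act_oneR)

section \<open>Words and histories\<close>

datatype tok = Tick | Lab nat

definition enc :: "(nat \<times> nat) list \<Rightarrow> tok list" where
  "enc es = concat (map (\<lambda>(l, v). Lab l # replicate v Tick) es)"

lemma enc_simps [simp]:
  "enc [] = []"
  "enc (e # es) = Lab (fst e) # replicate (snd e) Tick @ enc es"
  "enc (es @ es') = enc es @ enc es'"
  by (auto simp: enc_def split: prod.splits)

lemma replicate_Tick_split:
  "replicate w Tick @ u = p @ Lab l # r \<Longrightarrow> \<exists>p'. p = replicate w Tick @ p' \<and> u = p' @ Lab l # r"
proof (induction w arbitrary: p)
  case (Suc w)
  then obtain p0 where "p = Tick # p0" by (cases p) auto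
  then show ?case using Suc by auto
qed simp

text \<open>Labels stand only at the start of entries. This turns a factor of the word back into
  entries of the history.\<close>

lemma enc_eq_append_LabE:
  assumes "enc es = p @ Lab l # r"
  obtains e1 v e2 where "es = e1 @ (l, v) # e2" "p = enc e1" "r = replicate v Tick @ enc e2"
proof -
  have "\<exists>e1 v e2. es = e1 @ (l, v) # e2 \<and> p = enc e1 \<and> r = replicate v Tick @ enc e2"
    using assms
  proof (induction es arbitrary: p)
    case (Cons e es)
    show ?case
    proof (cases p)
      case Nil
      then have "e # es = [] @ (l, snd e) # es \<and> p = enc [] \<and> r = replicate (snd e) Tick @ enc es"
        using Cons.prems by (cases e) auto
      then show ?thesis by blast
    next
      case (Cons a p0)
      then have "replicate (snd e) Tick @ enc es = p0 @ Lab l # r" and a: "a = Lab (fst e)"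
        using Cons.prems by auto
      then obtain p' where p': "p0 = replicate (snd e) Tick @ p'" "enc es = p' @ Lab l # r"
        using replicate_Tick_split by blast
      then obtain e1 v e2 where "es = e1 @ (l, v) # e2" "p' = enc e1" "r = replicate v Tick @ enc e2"
        using Cons.IH by blast
      then have "e # es = (e # e1) @ (l, v) # e2 \<and> p = enc (e # e1) \<and> r = replicate v Tick @ enc e2"
        using p' a Cons by auto
      then show ?thesis by blast
    qed
  qed simp
  then show thesis using that by blast
qed

lemma enc_cases: "enc es = [] \<or> (\<exists>l r. enc es = Lab l # r)"
  by (cases es) auto

text \<open>An encoded history is empty or starts with a label, so a leading block of ticks has a
  definite end.\<close>

lemma ticks_enc_eq_ticks_Lab:
  "replicate v Tick @ enc e = replicate w Tick @ Lab l # r \<Longrightarrow> v = w \<and> enc e = Lab l # r"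
proof (induction v arbitrary: w)
  case 0
  then show ?case using enc_cases[of e] by (cases w) auto
next
  case (Suc v)
  then show ?case by (cases w) auto
qed

lemma ticks_enc_eq_ticks_le: "replicate v Tick @ enc e = replicate w Tick @ r \<Longrightarrow> w \<le> v"
proof (induction v arbitrary: w)
  case 0
  then show ?case using enc_cases[of e] by (cases w) auto
next
  case (Suc v)
  then show ?case by (cases w) auto
qed

lemma enc_inject: "enc e = enc e' \<Longrightarrow> e = e'"
proof (induction e arbitrary: e')
  case Nil
  then show ?case by (cases e') auto
next
  case (Cons a e)
  then obtain b e0 where e': "e' = b # e0" by (cases e') auto
  then have eq: "replicate (snd a) Tick @ enc e = replicate (snd b) Tick @ enc e0" "fst a = fst b"
    using Cons.prems by auto
  then have "snd a = snd b"
    by (metis ticks_enc_eq_ticks_le le_antisym)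
  then show ?case
    using eq e' Cons.IH by (cases a; cases b) auto
qed

section \<open>Variables for letters and their interpretation\<close>

abbreviation tick_var :: form where "tick_var \<equiv> Var 0"
abbreviation lab_var :: "nat \<Rightarrow> form" where "lab_var l \<equiv> Var (Suc (2 * l))"
abbreviation bal_var :: "nat \<Rightarrow> form" where "bal_var l \<equiv> Var (Suc (Suc (2 * l)))"

text \<open>The languages \<open>X\<close> of the balance variables stay a parameter: the machine
  supplies its own, and empty ones serve for formulae without balance variables.\<close>

definition tok_val :: "(nat \<Rightarrow> tok list set) \<Rightarrow> nat \<Rightarrow> tok list set" where
  "tok_val X n = (if n = 0 then {[Tick]} else if odd n then {[Lab (n div 2)]} else X (n div 2 - 1))"

lemma tok_val_simps [simp]:
  "tok_val X 0 = {[Tick]}"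
  "tok_val X (Suc (2 * l)) = {[Lab l]}"
  "tok_val X (Suc (Suc (2 * l))) = X l"
  "tok_val X (Suc 0) = {[Lab 0]}"
  by (auto simp: tok_val_def)

lemma tok_val_cases:
  assumes "w \<in> tok_val X n"
  obtains "n = 0" "w = [Tick]" | l where "n = Suc (2 * l)" "w = [Lab l]"
  | l where "n = Suc (Suc (2 * l))" "w \<in> X l"
proof -
  consider "n = 0" | l where "n = Suc (2 * l)" | l where "n = Suc (Suc (2 * l))"
    by (metis even_Suc evenE not0_implies_Suc oddE Suc_eq_plus1)
  then show thesis using assms that by cases auto
qed

lemma lang_Star_tick [simp]: "lang (tok_val X) (Star tick_var) = range (\<lambda>n. replicate n Tick)"
proof (intro equalityI subsetI)
  fix w assume "w \<in> lang (tok_val X) (Star tick_var)"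
  then obtain ws where "w = concat ws" "set ws \<subseteq> {[Tick]}" by auto
  moreover have "set ws \<subseteq> {[Tick]} \<Longrightarrow> concat ws = replicate (length ws) Tick"
    by (induction ws) auto
  ultimately show "w \<in> range (\<lambda>n. replicate n Tick)" by auto
next
  fix w assume "w \<in> range (\<lambda>n. replicate n Tick)"
  then obtain n where "w = replicate n Tick" by auto
  moreover have "concat (replicate n [Tick]) = replicate n Tick"
    by (induction n) auto
  ultimately have "w = concat (replicate n [Tick]) \<and> set (replicate n [Tick]) \<subseteq> {[Tick]}"
    by auto
  then show "w \<in> lang (tok_val X) (Star tick_var)"
    unfolding lang.simps tok_val_simps by blast
qed

lemma lang_lab_vars [simp]: "lang (tok_val X) (bigdisj (map lab_var ls)) = {[Lab l] | l. l \<in> set ls}"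
  by auto

lemma lang_entry:
  "lang (tok_val X) (bigdisj (map lab_var ls) \<bullet> Star tick_var)
    = {Lab l # replicate v Tick | l v. l \<in> set ls}"
  unfolding lang.simps(4) lang_Star_tick lang_lab_vars conc_def
  by (auto; metis append_Cons append_Nil rangeI)

lemma lang_Star_entries:
  "lang (tok_val X) (Star (bigdisj (map lab_var ls) \<bullet> Star tick_var))
    = {enc e | e. fst ` set e \<subseteq> set ls}"
proof (intro equalityI subsetI)
  have *: "\<exists>e. concat ws = enc e \<and> fst ` set e \<subseteq> set ls"
    if "set ws \<subseteq> {Lab l # replicate v Tick | l v. l \<in> set ls}" for ws
    using that
  proof (induction ws)
    case Nil
    show ?case by (rule exI[of _ "[]"]) simp
  next
    case (Cons u ws)
    then obtain e where e: "concat ws = enc e" "fst ` set e \<subseteq> set ls" by auto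
    obtain l n where "u = Lab l # replicate n Tick" "l \<in> set ls"
      using Cons.prems by auto
    then show ?case
      using e by (intro exI[of _ "(l, n) # e"]) simp
  qed
  fix w assume "w \<in> lang (tok_val X) (Star (bigdisj (map lab_var ls) \<bullet> Star tick_var))"
  then obtain ws where "w = concat ws" "set ws \<subseteq> {Lab l # replicate v Tick | l v. l \<in> set ls}"
    unfolding lang.simps(9) lang_entry by blast
  then show "w \<in> {enc e | e. fst ` set e \<subseteq> set ls}"
    using * by blast
next
  fix w assume "w \<in> {enc e | e. fst ` set e \<subseteq> set ls}"
  then obtain e where e: "w = enc e" "fst ` set e \<subseteq> set ls" by blast
  then have "set (map (\<lambda>(l, v). Lab l # replicate v Tick) e)
      \<subseteq> {Lab l # replicate v Tick | l v. l \<in> set ls}"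
    by (auto simp: image_subset_iff)
  then show "w \<in> lang (tok_val X) (Star (bigdisj (map lab_var ls) \<bullet> Star tick_var))"
    unfolding e(1) enc_def lang.simps(9) lang_entry by blast
qed

section \<open>Register machines, letter formulae and the goal\<close>

type_synonym instr = "bool \<times> nat \<times> nat \<times> nat \<times> nat"

definition opv :: "bool \<Rightarrow> nat \<Rightarrow> nat" where
  "opv i w = (if i then Suc w else w - 1)"

text \<open>\<open>two_le_R\<close> separates the label \<open>R - 1\<close>, which precedes the
  first instruction and must carry the value 0, from the label 0, whose value is the input. Jumps
  never lead back to initialising labels, but may lead to the two final ones.\<close>

locale machine =
  fixes R :: nat and P :: "instr list"
  assumes two_le_R: "2 \<le> R"
    and P_bounded: "\<And>i d s a b. (i, d, s, a, b) \<in> set P \<Longrightarrow>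
      s < R \<and> R \<le> a \<and> a \<le> Suc (R + length P) \<and> R \<le> b \<and> b \<le> Suc (R + length P)"
begin

text \<open>Labels below \<open>R\<close> initialise the register of the same number, the instruction \<open>P ! i\<close> has the
  label \<open>R + i\<close>, and the last two labels accept and reject.\<close>

definition acc :: nat where "acc = R + length P"
definition rej :: nat where "rej = Suc (R + length P)"
definition N :: nat where "N = Suc (Suc (R + length P))"
definition prog :: "nat \<Rightarrow> bool" where "prog l \<longleftrightarrow> R \<le> l \<and> l < acc"
definition inc :: "nat \<Rightarrow> bool" where "inc l = fst (P ! (l - R))"
text \<open>The final labels get the arbitrary default 0; a run stops there.\<close>

definition dst :: "nat \<Rightarrow> nat" where
  "dst l = (if l < R then l else if prog l then fst (snd (P ! (l - R))) else 0)"
definition src :: "nat \<Rightarrow> nat" where "src l = fst (snd (snd (P ! (l - R))))"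
definition nxt :: "nat \<Rightarrow> bool \<Rightarrow> nat" where
  "nxt l z = (if l < R then R else if z then fst (snd (snd (snd (P ! (l - R)))))
    else snd (snd (snd (snd (P ! (l - R))))))"

lemma prog_src: "prog l \<Longrightarrow> src l < R"
  and prog_nxt: "prog l \<Longrightarrow> R \<le> nxt l z \<and> nxt l z < N"
proof -
  assume l: "prog l"
  obtain i d s a b where P: "P ! (l - R) = (i, d, s, a, b)" by (metis prod.exhaust)
  moreover have "P ! (l - R) \<in> set P"
    using l by (auto simp: prog_def acc_def)
  ultimately have "s < R \<and> R \<le> a \<and> a \<le> Suc (R + length P) \<and> R \<le> b \<and> b \<le> Suc (R + length P)"
    using P_bounded[of i d s a b] by auto
  then show "src l < R" "R \<le> nxt l z \<and> nxt l z < N"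
    using P l by (auto simp: src_def nxt_def N_def prog_def)
qed

lemma label_bounds: "acc < N" "rej < N" "acc \<noteq> rej" "\<not> prog acc" "\<not> prog rej" "R \<le> acc" "R \<le> rej" "R < N"
  "prog l \<Longrightarrow> l < N"
  "prog l \<Longrightarrow> l < acc"
  by (auto simp: acc_def rej_def N_def prog_def)

definition quiet :: "nat \<Rightarrow> (nat \<times> nat) list \<Rightarrow> bool" where
  "quiet s e \<longleftrightarrow> (\<forall>x\<in>fst ` set e. dst x \<noteq> s)"

definition labs :: "(nat \<times> nat) list \<Rightarrow> bool" where
  "labs e \<longleftrightarrow> (\<forall>x\<in>fst ` set e. x < N)"

definition toks :: "tok list \<Rightarrow> bool" where
  "toks w \<longleftrightarrow> (\<forall>l. Lab l \<in> set w \<longrightarrow> l < N)"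

text \<open>The language of the grammar with the productions B -> quiet l and B -> tick B tick. If
  the left block of ticks is the value last written to the source of \<open>l\<close>, the right
  block compares it with the value that \<open>l\<close> writes.\<close>

definition balanced :: "nat \<Rightarrow> tok list set" where
  "balanced l = {replicate w Tick @ enc e @ Lab l # replicate w Tick | w e. quiet (src l) e \<and> labs e \<and> l < N}"

abbreviation V :: "nat \<Rightarrow> tok list set" where "V \<equiv> tok_val balanced"

definition quiet_form :: "nat \<Rightarrow> form" where
  "quiet_form s = Star (bigdisj (map lab_var (filter (\<lambda>x. dst x \<noteq> s) [0..<N])) \<bullet> Star tick_var)"

definition any_lab :: form where
  "any_lab = bigdisj (map lab_var [0..<N])"

definition any_form :: form where
  "any_form = Star (tick_var \<squnion> any_lab)"

text \<open>A lexicalised grammar: each letter offers itself or, through a division, a production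
  for a balance variable. A tick opens tick B tick, with the closing tick in the divisor; a label
  completes quiet l.\<close>

fun tok_form :: "tok \<Rightarrow> form" where
  "tok_form Tick = bigconj (map (\<lambda>l. bal_var l \<leftharpoondown> (bal_var l \<bullet> tick_var)) [0..<N]) tick_var"
| "tok_form (Lab l) = lab_var l \<sqinter> (quiet_form (src l) \<rightharpoondown> bal_var l)"

text \<open>A word in \<open>balanced l\<close> has as many ticks after \<open>l\<close> as before the entries that leave the source
  register of \<open>l\<close> alone. Added to the correct difference, a further tick on the right makes the value
  written by \<open>l\<close> too large; a missing one, with the next label following, makes it too small. The
  decrement of zero needs a separate case.\<close>

definition bad_value :: "nat \<Rightarrow> form" where
  "bad_value l = (if inc l
     then (bal_var l \<bullet> (tick_var \<bullet> tick_var)) \<squnion> (Star tick_var \<bullet> (bal_var l \<bullet> any_lab))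
     else (tick_var \<bullet> (bal_var l \<bullet> tick_var)) \<squnion> (quiet_form (src l) \<bullet> (lab_var l \<bullet> tick_var))
       \<squnion> (tick_var \<bullet> (tick_var \<bullet> (Star tick_var \<bullet> (bal_var l \<bullet> any_lab)))))"

text \<open>The accepting label counts as an error, so every accepting run ends in one; the
  rejecting label does not. The range starts at \<open>R - 1\<close> to check the jump into the
  first instruction. A tick after \<open>R - 1\<close> is an error because the fixed prefix of the
  query ends with this label and the run could otherwise enlarge its value.\<close>

definition error :: form where
  "error = bigdisj
    (lab_var acc # (lab_var (R - 1) \<bullet> tick_var)
      # [lab_var l \<bullet> lab_var l'. l \<leftarrow> [R - 1..<acc], l' \<leftarrow> [0..<N], l' \<noteq> nxt l True]
      @ [lab_var l \<bullet> (tick_var \<bullet> (Star tick_var \<bullet> lab_var l')).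
          l \<leftarrow> [R - 1..<acc], l' \<leftarrow> [0..<N], l' \<noteq> nxt l False]
      @ [lab_var x \<bullet> bad_value l. l \<leftarrow> [R..<acc], x \<leftarrow> [0..<N], dst x = src l])"

text \<open>The last factor is doubled because a star at the end of an antecedent can be absorbed
  from the left by the rule for the star on the right, but not from the right.\<close>

definition goal :: form where
  "goal = any_form \<bullet> (error \<bullet> (any_form \<bullet> any_form))"

lemma positive_forms [simp]: "positive (quiet_form s)" "positive any_form" "positive any_lab" "positive (bad_value l)" "positive error"
   "positive goal"
proof -
  show *: "positive (quiet_form s)" "positive any_form" "positive any_lab" for s
    by (auto simp: quiet_form_def any_form_def any_lab_def)
  show **: "positive (bad_value l)" for l
    by (simp add: bad_value_def *)
  show "positive error"
    unfolding error_def positive_bigdisj by (auto simp: **)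
  then show "positive goal"
    by (simp add: goal_def *)
qed

lemma lang_quiet_form: "lang (tok_val X) (quiet_form s) = {enc e | e. quiet s e \<and> labs e}"
  unfolding quiet_form_def lang_Star_entries by (auto simp: quiet_def labs_def)

lemma lang_any_lab [simp]: "lang (tok_val X) any_lab = {[Lab l] | l. l < N}"
  unfolding any_lab_def lang_lab_vars by auto

lemma lang_any_form [simp]: "lang (tok_val X) any_form = {w. toks w}"
proof (intro equalityI subsetI)
  fix w assume "w \<in> lang (tok_val X) any_form"
  then obtain ws where "w = concat ws" "set ws \<subseteq> insert [Tick] {[Lab l] | l. l < N}"
    by (auto simp: any_form_def)
  then show "w \<in> {w. toks w}" by (fastforce simp: toks_def)
next
  fix w assume "w \<in> {w. toks w}"
  then have "w = concat (map (\<lambda>a. [a]) w) \<and> set (map (\<lambda>a. [a]) w) \<subseteq> insert [Tick] {[Lab l] | l. l < N}"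
    by (auto simp: toks_def) (metis tok.exhaust)
  then have "w \<in> {concat ws | ws. set ws \<subseteq> insert [Tick] {[Lab l] | l. l < N}}" by blast
  then show "w \<in> lang (tok_val X) any_form" by (simp add: any_form_def)
qed

lemma act_tok_form_Tick: "[tok_form Tick] \<tturnstile> tick_var"
  unfolding tok_form.simps
  by (rule act_bigconjL[where \<Gamma> = "[]" and \<Delta> = "[]" and \<alpha> = tick_var, simplified]) (simp_all add: act_ax)

lemma act_tok_form_Lab: "[tok_form (Lab l)] \<tturnstile> lab_var l"
  using act_conjL1[where \<Gamma> = "[]" and \<Delta> = "[]"] act_ax by simp

text \<open>The word is parsed from the inside outwards: the label completes the innermost balance
  variable, and each opening tick then consumes that variable together with one closing
  tick.\<close>

lemma act_balanced:
  assumes "w \<in> balanced l"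
  shows "map tok_form w \<tturnstile> bal_var l"
proof -
  obtain n e where w: "w = replicate n Tick @ enc e @ Lab l # replicate n Tick"
    and e: "quiet (src l) e" "labs e" and l: "l < N"
    using assms by (auto simp: balanced_def)
  have "map tok_form (replicate n Tick @ enc e @ Lab l # replicate n Tick) \<tturnstile> bal_var l"
  proof (induction n)
    case 0
    have "map tok_form (enc e) \<tturnstile> quiet_form (src l)"
    \<comment> \<open>Balance variables get the empty language here: they do not occur in
      \<open>quiet_form\<close>, and their actual language would require the lemma being
      proved.\<close>
    proof (rule act_positive[where V = "tok_val (\<lambda>_. {})"])
      show "map tok_form w \<tturnstile> Var n" if "w \<in> tok_val (\<lambda>_. {}) n" for n w
        using that act_tok_form_Tick act_tok_form_Lab by (auto elim!: tok_val_cases)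
      show "enc e \<in> lang (tok_val (\<lambda>_. {})) (quiet_form (src l))"
        using e by (auto simp: lang_quiet_form)
    qed simp
    then have "map tok_form (enc e) @ [quiet_form (src l) \<rightharpoondown> bal_var l] \<tturnstile> bal_var l"
      by (rule act_ldivL)
    then show ?case
      using act_conjL2[where \<Delta> = "[]"] by simp
  next
    case (Suc n)
    let ?w = "replicate n Tick @ enc e @ Lab l # replicate n Tick"
    have "map tok_form ?w @ [tok_form Tick] \<tturnstile> bal_var l \<bullet> tick_var"
      using Suc act_tok_form_Tick by (rule act_prodR)
    then have "(bal_var l \<leftharpoondown> (bal_var l \<bullet> tick_var)) # map tok_form ?w @ [tok_form Tick] \<tturnstile> bal_var l"
      by (rule act_rdivL)
    then have "[] @ tok_form Tick # map tok_form ?w @ [tok_form Tick] \<tturnstile> bal_var l"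
      unfolding tok_form.simps(1)
      using l by (intro act_bigconjL[where \<alpha> = "bal_var l \<leftharpoondown> (bal_var l \<bullet> tick_var)"]) auto
    moreover have "tok_form Tick # map tok_form ?w @ [tok_form Tick]
       = map tok_form (replicate (Suc n) Tick @ enc e @ Lab l # replicate (Suc n) Tick)"
      by (simp add: replicate_append_same del: tok_form.simps)
    ultimately show ?case by simp
  qed
  then show ?thesis using w by simp
qed

lemma act_toks: "positive \<alpha> \<Longrightarrow> w \<in> lang V \<alpha> \<Longrightarrow> map tok_form w \<tturnstile> \<alpha>"
  by (rule act_positive) (auto elim!: tok_val_cases simp del: tok_form.simps
      intro: act_tok_form_Tick act_tok_form_Lab act_balanced)

text \<open>The semantic counterpart of \<open>act_balanced\<close>: the language
  \<open>balanced l\<close> is closed under the productions that the letters offer.\<close>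

lemma tok_in_lang: "toks [a] \<Longrightarrow> [a] \<in> lang V (tok_form a)"
proof (cases a)
  case Tick
  have "Tick # u @ [Tick] \<in> balanced l" if u: "u \<in> balanced l" for u l
  proof -
    obtain w e where "u = replicate w Tick @ enc e @ Lab l # replicate w Tick" "quiet (src l) e" "labs e" "l < N"
      using u by (auto simp: balanced_def)
    then have "Tick # u @ [Tick] = replicate (Suc w) Tick @ enc e @ Lab l # replicate (Suc w) Tick \<and>
        quiet (src l) e \<and> labs e \<and> l < N"
      by (auto simp: replicate_append_same)
    then show ?thesis unfolding balanced_def by blast
  qed
  then show ?thesis using Tick by (auto elim!: concE)
next
  case (Lab l)
  assume "toks [a]"
  then have "l < N" using Lab by (auto simp: toks_def)
  have "enc e @ [Lab l] \<in> balanced l" if "quiet (src l) e" "labs e" for e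
  proof -
    have "enc e @ [Lab l] = replicate 0 Tick @ enc e @ Lab l # replicate 0 Tick" by simp
    then show ?thesis using that \<open>l < N\<close> unfolding balanced_def by blast
  qed
  then show ?thesis using Lab by (auto simp: lang_quiet_form)
qed

lemma balancedI:
  "quiet (src l) e \<Longrightarrow> labs e \<Longrightarrow> l < N \<Longrightarrow> replicate w Tick @ enc e @ Lab l # replicate w Tick \<in> balanced l"
  unfolding balanced_def by blast

lemma ticks_in_V: "replicate n Tick \<in> lang V (Star tick_var)"
  unfolding lang_Star_tick by simp

lemma replicate_append_two: "replicate w a @ [a, a] = a # a # replicate w a"
  by (induction w) auto

lemma bad_value_long:
  assumes "quiet (src l) e" "labs e" "l < N"
  shows "replicate w Tick @ enc e @ Lab l # replicate (Suc (opv (inc l) w)) Tick \<in> lang V (bad_value l)"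
proof -
  \<comment> \<open>A decrement of 0 yields 0, so one tick is already too many, but there is no tick
    on the left to set apart; hence the middle case.\<close>
  consider "inc l" | "\<not> inc l" "w = 0" | w' where "\<not> inc l" "w = Suc w'"
    by (cases w) auto
  then show ?thesis
  proof cases
    case 1
    have "(replicate w Tick @ enc e @ Lab l # replicate w Tick) @ [Tick] @ [Tick]
        \<in> lang V (bal_var l \<bullet> (tick_var \<bullet> tick_var))"
      unfolding lang.simps(4) using balancedI[OF assms] by (intro concI) simp_all
    moreover have "(replicate w Tick @ enc e @ Lab l # replicate w Tick) @ [Tick] @ [Tick]
        = replicate w Tick @ enc e @ Lab l # replicate (Suc (opv (inc l) w)) Tick"
      using 1 by (simp add: opv_def replicate_append_two)
    ultimately show ?thesis using 1 by (auto simp: bad_value_def)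
  next
    case 2
    have "enc e @ [Lab l] @ [Tick] \<in> lang V (quiet_form (src l) \<bullet> (lab_var l \<bullet> tick_var))"
      unfolding lang.simps(4) using assms by (intro concI) (auto simp: lang_quiet_form)
    then show ?thesis using 2 by (auto simp: bad_value_def opv_def)
  next
    case 3
    have "[Tick] @ (replicate w' Tick @ enc e @ Lab l # replicate w' Tick) @ [Tick]
        \<in> lang V (tick_var \<bullet> (bal_var l \<bullet> tick_var))"
      unfolding lang.simps(4) using balancedI[OF assms] by (intro concI) simp_all
    moreover have "[Tick] @ (replicate w' Tick @ enc e @ Lab l # replicate w' Tick) @ [Tick]
        = replicate w Tick @ enc e @ Lab l # replicate (Suc (opv (inc l) w)) Tick"
      using 3 by (simp add: opv_def replicate_append_same)
    ultimately show ?thesis using 3 by (auto simp: bad_value_def)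
  qed
qed

lemma bad_value_short:
  assumes "quiet (src l) e" "labs e" "l < N" "j < opv (inc l) w" "x < N"
  shows "replicate w Tick @ enc e @ Lab l # replicate j Tick @ [Lab x] \<in> lang V (bad_value l)"
proof (cases "inc l")
  case True
  \<comment> \<open>Only \<open>j\<close> of the \<open>w\<close> ticks on the left are balanced;
    the star takes the others.\<close>
  have "replicate (w - j) Tick @ (replicate j Tick @ enc e @ Lab l # replicate j Tick) @ [Lab x]
      \<in> lang V (Star tick_var \<bullet> (bal_var l \<bullet> any_lab))"
    unfolding lang.simps(4) using balancedI[OF assms(1-3)] ticks_in_V assms(5)
    by (intro concI) simp_all
  moreover have "replicate (w - j) Tick @ replicate j Tick = replicate w Tick"
    using True assms(4) by (simp add: opv_def flip: replicate_add)
  then have "replicate (w - j) Tick @ (replicate j Tick @ enc e @ Lab l # replicate j Tick) @ [Lab x]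
      = replicate w Tick @ enc e @ Lab l # replicate j Tick @ [Lab x]"
    by (metis append.assoc append_Cons)
  ultimately show ?thesis using True by (simp only: bad_value_def if_True lang.simps(7) Un_iff simp_thms)
next
  case False
  \<comment> \<open>The right value is \<open>w - 1\<close>, so \<open>j < w - 1\<close> leaves at
    least two unbalanced ticks on the left; with just one, the value would be correct.\<close>
  have 1: "[Tick] @ [Tick] @ replicate (w - 2 - j) Tick @ (replicate j Tick @ enc e @ Lab l # replicate j Tick) @ [Lab x]
      \<in> lang V (tick_var \<bullet> (tick_var \<bullet> (Star tick_var \<bullet> (bal_var l \<bullet> any_lab))))"
    unfolding lang.simps(4) using balancedI[OF assms(1-3)] ticks_in_V assms(5)
    by (intro concI) simp_all
  have "[Tick] @ [Tick] @ replicate (w - 2 - j) Tick @ replicate j Tick = replicate (Suc (Suc (w - 2))) Tick"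
    using False assms(4) by (simp add: opv_def flip: replicate_add)
  moreover have "Suc (Suc (w - 2)) = w"
    using False assms(4) by (simp add: opv_def)
  ultimately have "[Tick] @ [Tick] @ replicate (w - 2 - j) Tick @ replicate j Tick = replicate w Tick"
    by (simp only:)
  then have "[Tick] @ [Tick] @ replicate (w - 2 - j) Tick @ (replicate j Tick @ enc e @ Lab l # replicate j Tick) @ [Lab x]
      = replicate w Tick @ enc e @ Lab l # replicate j Tick @ [Lab x]"
    by (metis append.assoc append_Cons)
  with 1 show ?thesis using False by (simp only: bad_value_def if_False lang.simps(7) Un_iff simp_thms)
qed

lemma bad_valueE:
  assumes "u \<in> lang V (bad_value l)"
  obtains w e r where "quiet (src l) e" "u = replicate w Tick @ enc e @ Lab l # r"
    "r = replicate (Suc (opv (inc l) w)) Tick \<or> (\<exists>j x. j < opv (inc l) w \<and> r = replicate j Tick @ [Lab x])"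
proof -
  have bal: "\<exists>w e. quiet (src l) e \<and> b = replicate w Tick @ enc e @ Lab l # replicate w Tick"
    if "b \<in> lang V (bal_var l)" for b
    using that by (auto simp: balanced_def)
  consider b where "inc l" "b \<in> lang V (bal_var l)" "u = b @ [Tick, Tick]"
    | n b x where "inc l" "b \<in> lang V (bal_var l)" "u = replicate n Tick @ b @ [Lab x]"
    | b where "\<not> inc l" "b \<in> lang V (bal_var l)" "u = Tick # b @ [Tick]"
    | e where "\<not> inc l" "quiet (src l) e" "u = enc e @ [Lab l, Tick]"
    | n b x where "\<not> inc l" "b \<in> lang V (bal_var l)" "u = Tick # Tick # replicate n Tick @ b @ [Lab x]"
    using assms
    by (cases "inc l") (auto simp: bad_value_def lang_quiet_form elim!: concE simp del: lang.simps(9))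
  then show thesis
  proof cases
    case 1
    then obtain w e where e: "quiet (src l) e" "b = replicate w Tick @ enc e @ Lab l # replicate w Tick"
      using bal by blast
    then have "u = replicate w Tick @ enc e @ Lab l # replicate (Suc (opv (inc l) w)) Tick"
      using 1 by (simp add: opv_def replicate_append_two)
    then show ?thesis using that[OF e(1)] by blast
  next
    case 2
    then obtain w e where e: "quiet (src l) e" "b = replicate w Tick @ enc e @ Lab l # replicate w Tick"
      using bal by blast
    have "u = replicate (n + w) Tick @ enc e @ Lab l # replicate w Tick @ [Lab x]"
      using 2(3) e(2) by (simp add: replicate_add)
    moreover have "w < opv (inc l) (n + w)" using 2(1) by (simp add: opv_def)
    ultimately show ?thesis using that[OF e(1)] by blast
  next
    case 3
    then obtain w e where e: "quiet (src l) e" "b = replicate w Tick @ enc e @ Lab l # replicate w Tick"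
      using bal by blast
    then have "u = replicate (Suc w) Tick @ enc e @ Lab l # replicate (Suc (opv (inc l) (Suc w))) Tick"
      using 3 by (simp add: opv_def replicate_append_same)
    then show ?thesis using that[OF e(1)] by blast
  next
    case 4
    then have "u = replicate 0 Tick @ enc e @ Lab l # replicate (Suc (opv (inc l) 0)) Tick"
      by (simp add: opv_def)
    then show ?thesis using that[OF 4(2)] by blast
  next
    case 5
    then obtain w e where e: "quiet (src l) e" "b = replicate w Tick @ enc e @ Lab l # replicate w Tick"
      using bal by blast
    have "u = replicate (Suc (Suc (n + w))) Tick @ enc e @ Lab l # replicate w Tick @ [Lab x]"
      using 5(3) e(2) by (simp add: replicate_add)
    moreover have "w < opv (inc l) (Suc (Suc (n + w)))" using 5(1) by (simp add: opv_def)
    ultimately show ?thesis using that[OF e(1)] by blast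
  qed
qed

lemma errorI:
  "[Lab acc] \<in> lang V error"
  "[Lab (R - 1), Tick] \<in> lang V error"
  "R - 1 \<le> l \<Longrightarrow> l < acc \<Longrightarrow> l' < N \<Longrightarrow> l' \<noteq> nxt l (v = 0) \<Longrightarrow> Lab l # replicate v Tick @ [Lab l'] \<in> lang V error"
  "prog l \<Longrightarrow> x < N \<Longrightarrow> dst x = src l \<Longrightarrow> u \<in> lang V (bad_value l) \<Longrightarrow> Lab x # u \<in> lang V error"
proof -
  show "[Lab acc] \<in> lang V error"
    unfolding error_def lang_bigdisj by simp
  have "[Lab (R - 1)] @ [Tick] \<in> lang V (lab_var (R - 1) \<bullet> tick_var)"
    unfolding lang.simps by (intro concI) auto
  then show "[Lab (R - 1), Tick] \<in> lang V error"
    unfolding error_def lang_bigdisj by simp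
next
  assume l: "R - 1 \<le> l" "l < acc" "l' < N" "l' \<noteq> nxt l (v = 0)"
  show "Lab l # replicate v Tick @ [Lab l'] \<in> lang V error"
  proof (cases v)
    case 0
    have "[Lab l] @ [Lab l'] \<in> lang V (lab_var l \<bullet> lab_var l')"
      unfolding lang.simps by (intro concI) auto
    then show ?thesis
      unfolding error_def lang_bigdisj using 0 l by (intro UN_I[of "lab_var l \<bullet> lab_var l'"]) auto
  next
    case (Suc v')
    have "[Lab l] @ [Tick] @ replicate v' Tick @ [Lab l']
        \<in> lang V (lab_var l \<bullet> (tick_var \<bullet> (Star tick_var \<bullet> lab_var l')))"
      unfolding lang.simps(4) using ticks_in_V by (intro concI) auto
    then show ?thesis
      unfolding error_def lang_bigdisj using Suc l
      by (intro UN_I[of "lab_var l \<bullet> (tick_var \<bullet> (Star tick_var \<bullet> lab_var l'))"]) auto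
  qed
next
  assume l: "prog l" "x < N" "dst x = src l" "u \<in> lang V (bad_value l)"
  have "[Lab x] @ u \<in> lang V (lab_var x \<bullet> bad_value l)"
    unfolding lang.simps(4) using l by (intro concI) auto
  then show "Lab x # u \<in> lang V error"
    unfolding error_def lang_bigdisj using l
    by (intro UN_I[of "lab_var x \<bullet> bad_value l"]) (auto simp: prog_def)
qed

lemma errorE:
  assumes "u \<in> lang V error"
  obtains "u = [Lab acc]"
  | "u = [Lab (R - 1), Tick]"
  | l l' v where "u = Lab l # replicate v Tick @ [Lab l']" "R - 1 \<le> l" "l < acc" "l' \<noteq> nxt l (v = 0)"
  | l x b where "u = Lab x # b" "b \<in> lang V (bad_value l)" "prog l" "dst x = src l"
proof -
  consider "u \<in> lang V (lab_var acc)" | "u \<in> lang V (lab_var (R - 1) \<bullet> tick_var)"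
    | l l' where "R - 1 \<le> l" "l < acc" "l' \<noteq> nxt l True" "u \<in> lang V (lab_var l \<bullet> lab_var l')"
    | l l' where "R - 1 \<le> l" "l < acc" "l' \<noteq> nxt l False"
      "u \<in> lang V (lab_var l \<bullet> (tick_var \<bullet> (Star tick_var \<bullet> lab_var l')))"
    | l x where "R \<le> l" "l < acc" "dst x = src l" "u \<in> lang V (lab_var x \<bullet> bad_value l)"
    using assms unfolding error_def lang_bigdisj by (auto simp del: lang.simps)
  then show thesis
  proof cases
    case 3
    then show ?thesis using that(3)[of l 0 l'] by (auto elim!: concE)
  next
    case 4
    then obtain v where "u = Lab l # replicate (Suc v) Tick @ [Lab l']"
      by (auto elim!: concE simp del: lang.simps(9))
    then show ?thesis using 4 that(3)[of l "Suc v" l'] by auto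
  next
    case 5
    then show ?thesis using that(4)[of x _ l] by (auto elim!: concE simp: prog_def)
  qed (use that(1,2) in \<open>auto elim!: concE\<close>)
qed

lemmas [simp del] = tok_form.simps

section \<open>Correct histories and the rejecting case\<close>

definition mem :: "(nat \<times> nat) list \<Rightarrow> nat \<Rightarrow> nat" where
  "mem es = fold (\<lambda>(l, v) m. m(dst l := v)) es (\<lambda>_. 0)"

lemma mem_simps [simp]:
  "mem [] = (\<lambda>_. 0)"
  "mem (es @ [(l, v)]) = (mem es)(dst l := v)"
  by (simp_all add: mem_def)

lemma mem_quiet: "quiet s e \<Longrightarrow> mem (es @ e) s = mem es s"
proof (induction e rule: rev_induct)
  case (snoc a e)
  then show ?case
    by (cases a) (auto simp: quiet_def simp flip: append_assoc)
qed simp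

lemma last_writer:
  assumes "s \<in> dst ` fst ` set es"
  shows "\<exists>e1 x e2. es = e1 @ (x, mem es s) # e2 \<and> dst x = s \<and> quiet s e2"
  using assms
proof (induction es rule: rev_induct)
  case (snoc a es)
  obtain l v where a: "a = (l, v)" by (cases a)
  show ?case
  proof (cases "dst l = s")
    case True
    then show ?thesis
      using a by (intro exI[of _ es] exI[of _ l] exI[of _ "[]"]) (auto simp: quiet_def)
  next
    case False
    then obtain e1 x e2 where "es = e1 @ (x, mem es s) # e2" "dst x = s" "quiet s e2"
      using snoc a by auto
    then have "es @ [a] = e1 @ (x, mem (es @ [a]) s) # (e2 @ [a]) \<and> dst x = s \<and> quiet s (e2 @ [a])"
      using False a by (auto simp: quiet_def)
    then show ?thesis by blast
  qed
qed simp

text \<open>Built backwards from the halting label \<open>h\<close>, so that rule induction follows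
  the rest of a run while the history varies. The zero test concerns the value just written.\<close>

inductive reaches :: "nat \<Rightarrow> nat \<Rightarrow> (nat \<Rightarrow> nat) \<Rightarrow> bool" for h where
  halt: "reaches h h m" for m
| step: "prog l \<Longrightarrow> v = opv (inc l) (m (src l)) \<Longrightarrow> reaches h (nxt l (v = 0)) (m(dst l := v))
    \<Longrightarrow> reaches h l m"

definition linked :: "(nat \<times> nat) list \<Rightarrow> nat \<Rightarrow> bool" where
  "linked es l \<longleftrightarrow> (\<exists>e0 l0 v0. es = e0 @ [(l0, v0)] \<and> R - 1 \<le> l0 \<and> l0 < acc \<and> l = nxt l0 (v0 = 0))"

text \<open>The clauses mirror the joinands of \<open>error\<close>, but speak of entries instead of
  factors of the word.\<close>

definition correct :: "(nat \<times> nat) list \<Rightarrow> bool" where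
  "correct es \<longleftrightarrow>
    (\<forall>e1 x w e2 l v e3. es = e1 @ (x, w) # e2 @ (l, v) # e3 \<longrightarrow> prog l \<longrightarrow> dst x = src l \<longrightarrow>
      quiet (src l) e2 \<longrightarrow> v = opv (inc l) w) \<and>
    (\<forall>e1 l v l' v' e3. es = e1 @ (l, v) # (l', v') # e3 \<longrightarrow> R - 1 \<le> l \<longrightarrow> l < acc \<longrightarrow>
      l' = nxt l (v = 0)) \<and>
    (\<forall>l v. (l, v) \<in> set es \<longrightarrow> l \<noteq> acc \<and> (l = R - 1 \<longrightarrow> v = 0))"

lemma correctD:
  assumes "correct es"
  shows "es = e1 @ (x, w) # e2 @ (l, v) # e3 \<Longrightarrow> prog l \<Longrightarrow> dst x = src l \<Longrightarrow> quiet (src l) e2 \<Longrightarrow>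
      v = opv (inc l) w"
    and "es = e1 @ (l, v) # (l', v') # e3 \<Longrightarrow> R - 1 \<le> l \<Longrightarrow> l < acc \<Longrightarrow> l' = nxt l (v = 0)"
    and "(l, v) \<in> set es \<Longrightarrow> l \<noteq> acc"
    and "(R - 1, v) \<in> set es \<Longrightarrow> v = 0"
  using assms unfolding correct_def by blast+

lemma ticks_enc_eq_ticks_enc:
  assumes "replicate v Tick @ enc e' = replicate w Tick @ enc e @ Lab l # r"
  shows "v = w \<and> enc e' = enc e @ Lab l # r"
  using assms ticks_enc_eq_ticks_Lab[of v e' w] by (cases e) auto

text \<open>Every error starts with a label, so unique readability of \<open>enc\<close> places it
  at an entry, where the matching clause of \<open>correct\<close> refutes it.\<close>

lemma correct_no_error:
  assumes "correct es" and "u \<in> lang V error"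
  shows "enc es \<noteq> p @ u @ q"
proof
  assume es: "enc es = p @ u @ q"
  show False
    using assms(2)
  proof (cases rule: errorE)
    case 1
    then have "enc es = p @ Lab acc # q" using es by simp
    then obtain e1 v e2 where "es = e1 @ (acc, v) # e2" by (rule enc_eq_append_LabE)
    then show False using correctD(3)[OF assms(1), of acc v] by simp
  next
    case 2
    then have "enc es = p @ Lab (R - 1) # Tick # q" using es by simp
    then obtain e1 v e2 where e: "es = e1 @ (R - 1, v) # e2" "Tick # q = replicate v Tick @ enc e2"
      by (rule enc_eq_append_LabE)
    then have "v = 0" using correctD(4)[OF assms(1), of v] by simp
    then show False using e(2) enc_cases[of e2] by auto
  next
    case (3 l l' w)
    then have "enc es = p @ Lab l # replicate w Tick @ Lab l' # q" using es by simp
    then obtain e1 v e2 where e: "es = e1 @ (l, v) # e2"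
      "replicate w Tick @ Lab l' # q = replicate v Tick @ enc e2"
      by (rule enc_eq_append_LabE)
    then have v: "v = w" and e2: "enc e2 = Lab l' # q"
      using ticks_enc_eq_ticks_Lab[of v e2 w l' q] by simp_all
    obtain v' e3 where "e2 = (l', v') # e3" using e2 by (cases e2) auto
    then show False using correctD(2)[OF assms(1), of e1 l v l' v' e3] 3 e(1) v by simp
  next
    case (4 l x b)
    obtain w e r where b: "quiet (src l) e" "b = replicate w Tick @ enc e @ Lab l # r"
      and r: "r = replicate (Suc (opv (inc l) w)) Tick \<or>
        (\<exists>j x. j < opv (inc l) w \<and> r = replicate j Tick @ [Lab x])"
      using bad_valueE[OF 4(2)] by metis
    have "enc es = p @ Lab x # replicate w Tick @ enc e @ Lab l # r @ q"
      using es 4 b by simp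
    then obtain e1 v e2 where e: "es = e1 @ (x, v) # e2"
      "replicate w Tick @ enc e @ Lab l # r @ q = replicate v Tick @ enc e2"
      by (rule enc_eq_append_LabE)
    then have v: "v = w" "enc e2 = enc e @ Lab l # r @ q"
      using ticks_enc_eq_ticks_enc[of v e2 w e l "r @ q"] by simp_all
    from v(2) obtain e0 v' e3 where e2: "e2 = e0 @ (l, v') # e3" "enc e = enc e0"
      "r @ q = replicate v' Tick @ enc e3"
      by (rule enc_eq_append_LabE)
    then have "e = e0" using enc_inject by blast
    then have v': "v' = opv (inc l) w"
      using correctD(1)[OF assms(1), of e1 x v e2' l v' e3 for e2'] e e2 b 4 v by simp
    from r show False
    proof
      assume "r = replicate (Suc (opv (inc l) w)) Tick"
      then show False
        using ticks_enc_eq_ticks_le[of v' e3 "Suc (opv (inc l) w)" q] e2(3) v' by simp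
    next
      assume "\<exists>j x. j < opv (inc l) w \<and> r = replicate j Tick @ [Lab x]"
      then obtain j x where j: "j < opv (inc l) w" "r = replicate j Tick @ [Lab x]" by blast
      then show False
        using ticks_enc_eq_ticks_Lab[of v' e3 j x q] e2(3) v' by simp
    qed
  qed
qed

lemma correct_append:
  assumes es: "correct es" and l: "linked es l" "R \<le> l" "l \<noteq> acc"
    and v: "prog l \<Longrightarrow> v = opv (inc l) (mem es (src l))"
  shows "correct (es @ [(l, v)])"
  unfolding correct_def
proof (intro conjI allI impI)
  fix e1 x w e2 l' v' e3
  assume e: "es @ [(l, v)] = e1 @ (x, w) # e2 @ (l', v') # e3" "prog l'" "dst x = src l'" "quiet (src l') e2"
  show "v' = opv (inc l') w"
  proof (cases e3 rule: rev_cases)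
    case Nil
    then have *: "es = (e1 @ [(x, w)]) @ e2" "l' = l" "v' = v"
      using e(1) by (simp_all flip: append_assoc append_Cons)
    have "mem es (src l') = w"
      using mem_quiet[OF e(4), of "e1 @ [(x, w)]"] e(3) unfolding *(1) by simp
    then show ?thesis using v e(2) * by simp
  next
    case (snoc e3' a)
    then have "es = e1 @ (x, w) # e2 @ (l', v') # e3'"
      using e(1) by (simp flip: append_assoc append_Cons)
    then show ?thesis using correctD(1)[OF es] e by blast
  qed
next
  fix e1 l1 v1 l' v' e3
  assume e: "es @ [(l, v)] = e1 @ (l1, v1) # (l', v') # e3" "R - 1 \<le> l1" "l1 < acc"
  show "l' = nxt l1 (v1 = 0)"
  proof (cases e3 rule: rev_cases)
    case Nil
    then have "es = e1 @ [(l1, v1)]" "l' = l"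
      using e(1) by (simp_all flip: append_assoc append_Cons)
    then show ?thesis using l by (auto simp: linked_def)
  next
    case (snoc e3' a)
    then have "es = e1 @ (l1, v1) # (l', v') # e3'"
      using e(1) by (simp flip: append_assoc append_Cons)
    then show ?thesis using correctD(2)[OF es] e by blast
  qed
next
  fix l' v' assume "(l', v') \<in> set (es @ [(l, v)])"
  then show "l' \<noteq> acc" using correctD(3)[OF es] l by auto
next
  fix l' v' assume "(l', v') \<in> set (es @ [(l, v)])" "l' = R - 1"
  then show "v' = 0" using correctD(4)[OF es] l two_le_R by auto
qed

lemma linked_append: "prog l \<Longrightarrow> linked (es @ [(l, v)]) (nxt l (v = 0))"
  by (auto simp: linked_def prog_def)

text \<open>The last entry gets the value 0 so that it is encoded by the bare label with which the
  query ends.\<close>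

lemma reaches_rej_correct:
  assumes "reaches rej l m" "mem es = m" "correct es" "linked es l"
  shows "\<exists>e. correct (es @ e @ [(rej, 0)]) \<and> labs e"
  using assms
proof (induction arbitrary: es rule: reaches.induct)
  case (halt m)
  then have "correct (es @ [] @ [(rej, 0)])"
    using correct_append[of es rej 0] label_bounds by simp
  then show ?case by (intro exI[of _ "[]"]) (simp add: labs_def)
next
  case (step l v m)
  have "correct (es @ [(l, v)])"
    using step label_bounds by (intro correct_append) (auto simp: prog_def)
  then have "\<exists>e. correct ((es @ [(l, v)]) @ e @ [(rej, 0)]) \<and> labs e"
    using step by (intro step.IH linked_append) auto
  then obtain e where "correct (es @ ((l, v) # e) @ [(rej, 0)])" "labs e" by auto
  moreover have "labs ((l, v) # e)"
    using \<open>labs e\<close> step label_bounds by (auto simp: labs_def)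
  ultimately show ?case by blast
qed

section \<open>The accepting case: unfolding the star along the run\<close>

definition run_form :: form where
  "run_form = Star (bigdisj (map tok_form (Tick # map Lab [0..<N])))"

text \<open>The state of the proof after the letters of \<open>w\<close> have been read, partly from
  the unfolded star.\<close>

definition wins :: "tok list \<Rightarrow> bool" where
  "wins w \<longleftrightarrow> map tok_form w @ [run_form, tok_form (Lab rej)] \<tturnstile> goal"

lemma toks_simps [simp]:
  "toks []" "toks (Tick # w) \<longleftrightarrow> toks w" "toks (Lab l # w) \<longleftrightarrow> l < N \<and> toks w"
  "toks (u @ w) \<longleftrightarrow> toks u \<and> toks w" "toks (replicate n Tick)"
  by (auto simp: toks_def)

lemma toks_enc [simp]: "toks (enc e) \<longleftrightarrow> labs e"
  by (induction e) (auto simp: labs_def)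

lemma act_tok_any: "toks [a] \<Longrightarrow> [tok_form a] \<tturnstile> tick_var \<squnion> any_lab"
  using act_toks[of "tick_var \<squnion> any_lab" "[a]"] by (cases a) auto

lemma alphabetE:
  assumes "\<alpha> \<in> set (map tok_form (Tick # map Lab [0..<N]))"
  obtains a where "\<alpha> = tok_form a" "toks [a]"
proof -
  obtain a where "\<alpha> = tok_form a" "a \<in> set (Tick # map Lab [0..<N])"
    using assms unfolding set_map by blast
  then show ?thesis using that by auto
qed

lemma act_run_any: "[run_form] \<tturnstile> any_form"
  unfolding run_form_def any_form_def
proof (rule act_star_mono)
  have "[\<alpha>] \<tturnstile> tick_var \<squnion> any_lab" if \<alpha>: "\<alpha> \<in> set (map tok_form (Tick # map Lab [0..<N]))" for \<alpha>
  proof -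
    obtain a where "\<alpha> = tok_form a" "toks [a]" using \<alpha> by (rule alphabetE)
    then show ?thesis using act_tok_any by simp
  qed
  then show "[bigdisj (map tok_form (Tick # map Lab [0..<N]))] \<tturnstile> tick_var \<squnion> any_lab"
    using act_bigdisjL[of "map tok_form (Tick # map Lab [0..<N])" "[]" "[]"] unfolding append_Nil by blast
qed

lemma act_toks_run: "toks q \<Longrightarrow> map tok_form q @ [run_form] \<tturnstile> any_form"
proof (induction q)
  case Nil
  then show ?case using act_run_any by simp
next
  case (Cons a q)
  then have "toks [a]" "toks q" by (cases a; simp)+
  then show ?case
    using act_starR[OF act_tok_any Cons.IH[unfolded any_form_def]] by (simp add: any_form_def del: tok_form.simps)
qed

text \<open>Of the two trailing factors of the goal, the first absorbs \<open>q\<close> and the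
  star, the second the rejecting label. The second claim is for the branch in which the star has
  ended.\<close>

lemma error_wins:
  assumes "u \<in> lang V error" "toks p" "toks q"
  shows "wins (p @ u @ q)" and "map tok_form (p @ u @ q) \<tturnstile> goal"
proof -
  have p: "map tok_form p \<tturnstile> any_form" and u: "map tok_form u \<tturnstile> error"
    using assms by (auto intro!: act_toks)
  have "(map tok_form q @ [run_form]) @ map tok_form [Lab rej] \<tturnstile> any_form \<bullet> any_form"
    using assms label_bounds by (intro act_prodR act_toks_run act_toks) auto
  from act_prodR[OF p act_prodR[OF u this]] show "wins (p @ u @ q)"
    by (simp add: wins_def goal_def del: tok_form.simps)
  have "map tok_form q @ map tok_form [] \<tturnstile> any_form \<bullet> any_form"
    using assms by (intro act_prodR act_toks) auto
  from act_prodR[OF p act_prodR[OF u this]] show "map tok_form (p @ u @ q) \<tturnstile> goal"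
    by (simp add: goal_def del: tok_form.simps)
qed

definition faulty :: "tok list \<Rightarrow> bool" where
  "faulty w \<longleftrightarrow> (\<exists>p u q. w = p @ u @ q \<and> u \<in> lang V error \<and> toks p \<and> toks q)"

lemma faultyI: "u \<in> lang V error \<Longrightarrow> toks p \<Longrightarrow> toks q \<Longrightarrow> faulty (p @ u @ q)"
  unfolding faulty_def by blast

text \<open>One unfolding of the star. If it ends, the next letter is the rejecting label, which
  differs from \<open>c\<close> and so creates an error; if it goes on, every letter except
  \<open>c\<close> creates one.\<close>

lemma wins_step:
  assumes "wins (w @ [c])" "c \<noteq> Lab rej" "\<And>a. a \<noteq> c \<Longrightarrow> toks [a] \<Longrightarrow> faulty (w @ [a])"
  shows "wins w"
  unfolding wins_def run_form_def
proof (rule act_star_unfold)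
  have "faulty (w @ [Lab rej])" using assms label_bounds by simp
  then show "map tok_form w @ [tok_form (Lab rej)] \<tturnstile> goal"
    unfolding faulty_def using error_wins(2) by (metis map_append list.simps(8,9))
next
  have "map tok_form w @ tok_form a # run_form # [tok_form (Lab rej)] \<tturnstile> goal" if "toks [a]" for a
  proof -
    have "wins (w @ [a])"
      using assms(1) assms(3)[of a] that error_wins(1) by (cases "a = c") (auto simp: faulty_def)
    then show ?thesis by (simp add: wins_def del: tok_form.simps)
  qed
  then show "map tok_form w @ bigdisj (map tok_form (Tick # map Lab [0..<N])) #
      Star (bigdisj (map tok_form (Tick # map Lab [0..<N]))) # [tok_form (Lab rej)] \<tturnstile> goal"
    unfolding run_form_def by (intro act_bigdisjL) (elim alphabetE; simp only:)
qed

text \<open>As every source has been written, it has a last writer; the error extends from that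
  entry to the end of the word.\<close>

lemma faulty_long:
  assumes "dst ` fst ` set es \<supseteq> {..<R}" "labs es" "prog l"
  shows "faulty (enc es @ Lab l # replicate (Suc (opv (inc l) (mem es (src l)))) Tick)" (is ?long)
    and "j < opv (inc l) (mem es (src l)) \<Longrightarrow> x < N \<Longrightarrow>
      faulty (enc es @ Lab l # replicate j Tick @ [Lab x])"
proof -
  obtain e1 y e2 where e: "es = e1 @ (y, mem es (src l)) # e2" "dst y = src l" "quiet (src l) e2"
    using last_writer[of "src l" es] assms prog_src by blast
  let ?w = "mem es (src l)"
  have es: "enc es = enc e1 @ Lab y # replicate ?w Tick @ enc e2" and "labs e1" "labs e2" "y < N"
    using arg_cong[OF e(1), of enc] arg_cong[OF e(1), of labs] assms(2) by (auto simp: labs_def)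
  have l: "l < N" using assms(3) label_bounds by simp
  have "Lab y # replicate ?w Tick @ enc e2 @ Lab l # replicate (Suc (opv (inc l) ?w)) Tick \<in> lang V error"
    by (rule errorI(4)[OF assms(3) \<open>y < N\<close> e(2) bad_value_long[OF e(3) \<open>labs e2\<close> l]])
  from faultyI[OF this, of "enc e1" "[]"] show ?long
    using es \<open>labs e1\<close> by simp
  assume j: "j < opv (inc l) ?w" "x < N"
  have "Lab y # replicate ?w Tick @ enc e2 @ Lab l # replicate j Tick @ [Lab x] \<in> lang V error"
    by (rule errorI(4)[OF assms(3) \<open>y < N\<close> e(2) bad_value_short[OF e(3) \<open>labs e2\<close> l j]])
  from faultyI[OF this, of "enc e1" "[]"]
  show "faulty (enc es @ Lab l # replicate j Tick @ [Lab x])"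
    using es \<open>labs e1\<close> by simp
qed

lemma faulty_jump:
  assumes "labs es" "R - 1 \<le> l" "l < acc" "x < N" "x \<noteq> nxt l (v = 0)"
  shows "faulty (enc es @ Lab l # replicate v Tick @ [Lab x])"
proof -
  have "faulty (enc es @ (Lab l # replicate v Tick @ [Lab x]) @ [])"
    using assms label_bounds(1) by (intro faultyI errorI(3)) auto
  then show ?thesis by simp
qed

text \<open>The induction hypothesis covers the word with the complete entry and the next label.
  From there \<open>wins_step\<close> removes that label and then the ticks one by one, each being
  the only faultless letter at its place.\<close>

lemma reaches_acc_wins:
  assumes "reaches acc l m" "mem es = m" "dst ` fst ` set es \<supseteq> {..<R}" "labs es"
  shows "wins (enc es @ [Lab l])"
  using assms
proof (induction arbitrary: es rule: reaches.induct)
  case (halt m)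
  then show ?case
    using error_wins(1)[OF errorI(1), of "enc es" "[]"] by simp
next
  case (step l v m)
  define l' where "l' = nxt l (v = 0)"
  have v: "v = opv (inc l) (mem es (src l))" using step.hyps(2) step.prems(1) by simp
  note long = faulty_long(1)[OF step.prems(2,3) step.hyps(1)]
    and short = faulty_long(2)[OF step.prems(2,3) step.hyps(1)]
  have l: "l < N" "l < acc" "R - 1 \<le> l" using step.hyps(1) label_bounds by (auto simp: prog_def)
  \<comment> \<open>No run leads on from the rejecting label, so it cannot occur on the way to
    \<open>acc\<close>.\<close>
  have l': "l' \<noteq> rej"
    using step.hyps(3) label_bounds unfolding l'_def by (metis reaches.cases)
  have "wins (enc (es @ [(l, v)]) @ [Lab l'])"
    unfolding l'_def
  proof (rule step.IH)
    show "mem (es @ [(l, v)]) = m(dst l := v)" using step.prems(1) by simp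
    show "{..<R} \<subseteq> dst ` fst ` set (es @ [(l, v)])" using step.prems(2) by auto
    show "labs (es @ [(l, v)])" using step.prems(3) l by (auto simp: labs_def)
  qed
  then have "wins ((enc es @ Lab l # replicate v Tick) @ [Lab l'])" by simp
  then have "wins (enc es @ Lab l # replicate v Tick)"
  proof (rule wins_step)
    fix a assume a: "a \<noteq> Lab l'" "toks [a]"
    show "faulty ((enc es @ Lab l # replicate v Tick) @ [a])"
    proof (cases a)
      case Tick
      then show ?thesis
        using long v by (simp add: replicate_append_same)
    next
      case (Lab x)
      then show ?thesis
        using faulty_jump[of es l x v] step.prems(3) l a by (simp add: l'_def)
    qed
  qed (use l' in simp_all)
  \<comment> \<open>\<open>i\<close> counts the ticks already removed from the end of the
    entry.\<close>
  then have "wins (enc es @ Lab l # replicate (v - i) Tick)" if "i \<le> v" for i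
    using that
  proof (induction i)
    case (Suc i)
    then have "wins ((enc es @ Lab l # replicate (v - Suc i) Tick) @ [Tick])"
      by (simp add: replicate_append_same Suc_diff_Suc flip: replicate_Suc)
    then show ?case
    proof (rule wins_step)
      fix a assume a: "a \<noteq> Tick" "toks [a]"
      then obtain x where "a = Lab x" "x < N" by (cases a) auto
      then show "faulty ((enc es @ Lab l # replicate (v - Suc i) Tick) @ [a])"
        using short[of "v - Suc i" x] v Suc.prems by simp
    qed simp
  qed simp
  from this[of v] show ?case by simp
qed

section \<open>The initial history and the query\<close>

definition init :: "nat \<Rightarrow> (nat \<times> nat) list" where
  "init n = (0, n) # map (\<lambda>j. (j, 0)) [1..<R]"

lemma enc_init: "enc (init n) = Lab 0 # replicate n Tick @ map Lab [1..<R]"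
proof -
  have "enc (map (\<lambda>j. (j, 0)) js) = map Lab js" for js
    by (induction js) auto
  then show ?thesis by (simp add: init_def)
qed

lemma mem_init: "mem (init n) = (\<lambda>s. if s = 0 then n else 0)"
proof -
  have "mem ((0, n) # map (\<lambda>j. (j, 0)) js) = (\<lambda>s. if s = 0 then n else 0)"
    if "set js \<subseteq> {1..<R}" for js
    using that
  proof (induction js rule: rev_induct)
    case Nil
    then show ?case using two_le_R by (auto simp: mem_def dst_def)
  next
    case (snoc j js)
    then have "mem (((0, n) # map (\<lambda>j. (j, 0)) js) @ [(j, 0)]) = (\<lambda>s. if s = 0 then n else 0)"
      unfolding mem_simps by (auto simp: dst_def)
    then show ?case by simp
  qed
  then show ?thesis by (simp add: init_def)
qed

lemma init_labels: "fst ` set (init n) = {..<R}"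
  using two_le_R by (auto simp: init_def image_iff)

lemma init_writes: "dst ` fst ` set (init n) \<supseteq> {..<R}" "labs (init n)"
  unfolding labs_def init_labels using label_bounds by (auto simp: dst_def)

lemma init_snoc: "\<exists>es. init n = es @ [(R - 1, 0)] \<and> fst ` set es \<subseteq> {..<R - 1}"
proof -
  have "[1..<R] = [1..<R - 1] @ [R - 1]"
    using two_le_R upt_Suc_append[of 1 "R - 1"] by simp
  then have "init n = ((0, n) # map (\<lambda>j. (j, 0)) [1..<R - 1]) @ [(R - 1, 0)]"
    by (simp add: init_def)
  then show ?thesis using two_le_R by fastforce
qed

lemma linked_init: "linked (init n) R"
proof -
  obtain es where "init n = es @ [(R - 1, 0)]" using init_snoc by blast
  moreover have "R - 1 < acc" "R = nxt (R - 1) (0 = (0 :: nat))"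
    using two_le_R by (auto simp: acc_def nxt_def)
  ultimately show ?thesis unfolding linked_def by blast
qed

lemma correct_init: "correct (init n)"
  unfolding correct_def
proof (intro conjI allI impI)
  fix e1 x w e2 l v e3
  assume "init n = e1 @ (x, w) # e2 @ (l, v) # e3" "prog l"
  then have "l \<in> fst ` set (init n)" by (simp add: image_Un)
  then show "v = opv (inc l) w" using \<open>prog l\<close> by (simp add: init_labels prog_def)
next
  fix e1 l v l' v' e3
  assume e: "init n = e1 @ (l, v) # (l', v') # e3" "R - 1 \<le> l"
  obtain es where es: "init n = es @ [(R - 1, 0)]" "fst ` set es \<subseteq> {..<R - 1}"
    using init_snoc by blast
  have "(l, v) \<in> set es"
    using e(1) es(1) by (cases e3 rule: rev_cases) (auto simp flip: append_assoc append_Cons)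
  then show "l' = nxt l (v = 0)" using es(2) e(2) by force
next
  fix l v assume l: "(l, v) \<in> set (init n)"
  then show "l \<noteq> acc" using init_labels[of n] by (force simp: acc_def)
next
  fix l v assume l: "(l, v) \<in> set (init n)" "l = R - 1"
  then show "v = 0" using two_le_R by (auto simp: init_def)
qed

text \<open>Written so that \<open>n\<close> occurs only as a number of copies of one formula;
  everything else depends on the program alone, which self-reference exploits.\<close>

definition query :: "nat \<Rightarrow> sequent" where
  "query n = (tok_form (Lab 0) # replicate n (tok_form Tick) @
    map (tok_form \<circ> Lab) [1..<R] @ [run_form, tok_form (Lab rej)] \<turnstile> goal)"

lemma query_alt: "query n = (map tok_form (enc (init n)) @ [run_form, tok_form (Lab rej)] \<turnstile> goal)"
  by (simp add: query_def enc_init del: tok_form.simps)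

lemma query_in_ACT:
  assumes "reaches acc R (\<lambda>s. if s = 0 then n else 0)"
  shows "query n \<in> ACT"
proof -
  have R: "R \<noteq> rej" by (simp add: rej_def)
  have "wins (enc (init n) @ [Lab R])"
    using assms mem_init init_writes by (intro reaches_acc_wins) auto
  then have "wins (enc (init n))"
  proof (rule wins_step)
    fix a assume a: "a \<noteq> Lab R" "toks [a]"
    obtain es where es: "init n = es @ [(R - 1, 0)]" using init_snoc by blast
    then have "labs es" using init_writes(2)[of n] by (simp add: labs_def)
    show "faulty (enc (init n) @ [a])"
    proof (cases a)
      case Tick
      have "faulty (enc es @ [Lab (R - 1), Tick] @ [])"
        using \<open>labs es\<close> by (intro faultyI errorI(2)) auto
      then show ?thesis using es Tick by simp
    next
      case (Lab x)
      then have "faulty (enc es @ Lab (R - 1) # replicate 0 Tick @ [Lab x])"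
        using \<open>labs es\<close> a two_le_R by (intro faulty_jump) (auto simp: acc_def nxt_def)
      then show ?thesis using es Lab by simp
    qed
  qed (use R in simp)
  then show ?thesis by (simp add: wins_def query_alt act_def)
qed

lemma toks_in_langs: "toks w \<Longrightarrow> w \<in> langs V (map tok_form w)"
proof (induction w)
  case (Cons a w)
  then have "[a] \<in> lang V (tok_form a)" "toks w"
    by (cases a; simp add: tok_in_lang del: tok_form.simps)+
  then have "[a] @ w \<in> langs V (map tok_form (a # w))"
    unfolding list.simps langs.simps by (intro concI Cons.IH)
  then show ?case by simp
qed simp

lemma toks_in_run: "toks w \<Longrightarrow> w \<in> lang V run_form"
proof -
  assume w: "toks w"
  have "[a] \<in> lang V (bigdisj (map tok_form (Tick # map Lab [0..<N])))" if "a \<in> set w" for a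
  proof -
    have "toks [a]" using w that by (auto simp: toks_def)
    then have "[a] \<in> lang V (tok_form a)" by (rule tok_in_lang)
    moreover have "a \<in> set (Tick # map Lab [0..<N])"
      using \<open>toks [a]\<close> by (cases a) auto
    ultimately show ?thesis unfolding lang_bigdisj set_map by blast
  qed
  then have "set (map (\<lambda>a. [a]) w) \<subseteq> lang V (bigdisj (map tok_form (Tick # map Lab [0..<N])))"
    by auto
  moreover have "w = concat (map (\<lambda>a. [a]) w)" by simp
  ultimately show ?thesis unfolding run_form_def lang.simps(9) by blast
qed

lemma query_not_in_ACT_omega_D:
  assumes "reaches rej R (\<lambda>s. if s = 0 then n else 0)"
  shows "query n \<notin> ACT_omega_D"
proof
  assume "query n \<in> ACT_omega_D"
  then have valid: "langs V (map tok_form (enc (init n)) @ [run_form, tok_form (Lab rej)]) \<subseteq> lang V goal"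
    using ACT_omega_D_valid[of "query n" V] by (simp only: query_alt valid.simps)
  obtain e where e: "correct (init n @ e @ [(rej, 0)])" "labs e"
    using reaches_rej_correct[OF assms mem_init correct_init linked_init] by blast
  have "enc (init n) @ enc e @ [Lab rej] \<in> langs V (map tok_form (enc (init n)) @ [run_form, tok_form (Lab rej)])"
    unfolding langs_append langs.simps conc_Nil
    using init_writes e label_bounds
    by (intro concI toks_in_langs toks_in_run tok_in_lang) auto
  then have "enc (init n @ e @ [(rej, 0)]) \<in> lang V goal"
    using valid by auto
  then obtain p u q where "enc (init n @ e @ [(rej, 0)]) = p @ u @ q" "u \<in> lang V error"
    unfolding goal_def lang.simps(4) by (elim concE) auto
  then show False
    using correct_no_error[OF e(1)] by blast
qed

end

section \<open>Loop programs\<close>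

datatype com = Upd bool nat nat | Seq com com | When nat com | Loop nat com

fun sem :: "com \<Rightarrow> (nat \<Rightarrow> nat) \<Rightarrow> (nat \<Rightarrow> nat)" where
  "sem (Upd i d s) m = m(d := opv i (m s))"
| "sem (Seq c c') m = sem c' (sem c m)"
| "sem (When r c) m = (if m r = 0 then m else sem c m)"
| "sem (Loop r c) m = ((\<lambda>m. sem c (m(r := m r - 1))) ^^ m r) m"

primrec writes :: "com \<Rightarrow> nat set" where
  "writes (Upd i d s) = {d}"
| "writes (Seq c c') = writes c \<union> writes c'"
| "writes (When r c) = writes c"
| "writes (Loop r c) = insert r (writes c)"

text \<open>\<open>sem\<close> fixes the number of passes at the start, whereas the machine tests
  the register before each pass; the two agree if the body leaves the register alone.\<close>

primrec safe :: "com \<Rightarrow> bool" where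
  "safe (Upd i d s) \<longleftrightarrow> True"
| "safe (Seq c c') \<longleftrightarrow> safe c \<and> safe c'"
| "safe (When r c) \<longleftrightarrow> safe c"
| "safe (Loop r c) \<longleftrightarrow> safe c \<and> r \<notin> writes c"

lemma sem_unchanged: "x \<notin> writes c \<Longrightarrow> sem c m x = m x"
proof (induction c arbitrary: m)
  case (Loop r c)
  have "((\<lambda>m. sem c (m(r := m r - 1))) ^^ n) m x = m x" for n
    using Loop by (induction n) auto
  then show ?case by simp
qed auto

text \<open>Counts the registers that are read: these need an initialising entry, since the value of
  a source is looked up in its last writing entry.\<close>

primrec reg_bound :: "com \<Rightarrow> nat" where
  "reg_bound (Upd i d s) = Suc s"
| "reg_bound (Seq c c') = max (reg_bound c) (reg_bound c')"
| "reg_bound (When r c) = max (Suc r) (reg_bound c)"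
| "reg_bound (Loop r c) = max (Suc r) (reg_bound c)"

primrec code_length :: "com \<Rightarrow> nat" where
  "code_length (Upd i d s) = 1"
| "code_length (Seq c c') = code_length c + code_length c'"
| "code_length (When r c) = 2 + code_length c"
| "code_length (Loop r c) = 3 + code_length c"

text \<open>Incrementing and then decrementing a register leaves it unchanged and branches on
  whether it is zero.\<close>

primrec code :: "com \<Rightarrow> nat \<Rightarrow> nat \<Rightarrow> instr list" where
  "code (Upd i d s) b e = [(i, d, s, e, e)]"
| "code (Seq c c') b e = code c b (b + code_length c) @ code c' (b + code_length c) e"
| "code (When r c) b e = (True, r, r, b + 1, b + 1) # (False, r, r, e, b + 2) # code c (b + 2) e"
| "code (Loop r c) b e = (True, r, r, b + 1, b + 1) # (False, r, r, e, b + 2)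
    # (False, r, r, b + 3, b + 3) # code c (b + 3) b"

lemma length_code [simp]: "length (code c b e) = code_length c"
  by (induction c arbitrary: b e) auto

lemma code_length_pos: "0 < code_length c"
  by (induction c) auto

lemma code_bounded:
  assumes "(i, d, s, z, nz) \<in> set (code c b e)"
    and "lo \<le> b" "b + code_length c \<le> hi" "lo \<le> e" "e \<le> hi"
  shows "s < reg_bound c \<and> lo \<le> z \<and> z \<le> hi \<and> lo \<le> nz \<and> nz \<le> hi"
  using assms
proof (induction c arbitrary: b e)
  case (Seq c1 c2)
  then consider "(i, d, s, z, nz) \<in> set (code c1 b (b + code_length c1))"
    | "(i, d, s, z, nz) \<in> set (code c2 (b + code_length c1) e)" by auto
  then show ?case
  proof cases
    case 1
    from Seq.IH(1)[OF this] Seq.prems show ?thesis by auto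
  next
    case 2
    from Seq.IH(2)[OF this] Seq.prems show ?thesis by auto
  qed
next
  case (When r c)
  show ?case
  proof (cases "(i, d, s, z, nz) \<in> set (code c (b + 2) e)")
    case True
    from When.IH[OF this] When.prems show ?thesis by auto
  qed (use When.prems code_length_pos[of c] in auto)
next
  case (Loop r c)
  show ?case
  proof (cases "(i, d, s, z, nz) \<in> set (code c (b + 3) b)")
    case True
    from Loop.IH[OF this] Loop.prems show ?thesis by auto
  qed (use Loop.prems code_length_pos[of c] in auto)
qed auto

section \<open>Execution of loop programs by the machine\<close>

context machine begin

definition loaded :: "nat \<Rightarrow> instr list \<Rightarrow> bool" where
  "loaded b is \<longleftrightarrow> (\<exists>pre post. P = pre @ is @ post \<and> b = R + length pre)"

lemma loaded_append:
  assumes "loaded b (is @ is')"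
  shows "loaded b is" "loaded (b + length is) is'"
proof -
  obtain pre post where P: "P = pre @ (is @ is') @ post" "b = R + length pre"
    using assms by (auto simp: loaded_def)
  then have "P = pre @ is @ (is' @ post) \<and> b = R + length pre"
    and "P = (pre @ is) @ is' @ post \<and> b + length is = R + length (pre @ is)" by auto
  then show "loaded b is" "loaded (b + length is) is'"
    unfolding loaded_def by blast+
qed

lemma loaded_Cons:
  assumes "loaded b (i # is)"
  shows "loaded b [i]" "loaded (Suc b) is"
  using loaded_append[of b "[i]" "is"] assms by auto

lemma reaches_instr:
  assumes "loaded b [(i, d, s, z, nz)]" "v = opv i (m s)"
    and "reaches h (if v = 0 then z else nz) (m(d := v))"
  shows "reaches h b m"
proof -
  obtain pre post where P: "P = pre @ [(i, d, s, z, nz)] @ post" and b: "b = R + length pre"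
    using assms(1) by (auto simp: loaded_def)
  then have "P ! (b - R) = (i, d, s, z, nz)" by (simp add: nth_append)
  moreover have "length P = Suc (length pre + length post)" using P by simp
  then have "prog b" using b by (simp add: prog_def acc_def)
  ultimately have "prog b" "inc b = i" "src b = s" "dst b = d" "nxt b (v = 0) = (if v = 0 then z else nz)"
    by (auto simp: inc_def src_def dst_def nxt_def prog_def)
  then show ?thesis
    using assms(2,3) reaches.step[of b v m h] by simp
qed

lemma reaches_test:
  assumes "loaded b ((True, r, r, Suc b, Suc b) # (False, r, r, z, nz) # is)"
    and "reaches h (if m r = 0 then z else nz) m"
  shows "reaches h b m"
proof -
  note l = loaded_Cons[OF assms(1)]
  have "reaches h (Suc b) (m(r := Suc (m r)))"
    using assms(2) by (intro reaches_instr[OF loaded_Cons(1)[OF l(2)] refl]) (simp add: opv_def)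
  then show ?thesis
    by (intro reaches_instr[OF l(1) refl]) (simp add: opv_def)
qed

text \<open>Stated with an arbitrary continuation at the exit \<open>e\<close>, so that sequencing
  is composition and a loop can use its own start as the exit of its body.\<close>

lemma reaches_code:
  assumes "loaded b (code c b e)" "safe c" "reaches h e (sem c m)"
  shows "reaches h b m"
  using assms
proof (induction c arbitrary: b e m)
  case (Upd i d s)
  then show ?case
    by (intro reaches_instr[of b i d s e e "opv i (m s)" m]) (simp_all only: sem.simps code.simps if_cancel)
next
  case (Seq c c')
  note l = loaded_append[OF Seq.prems(1)[unfolded code.simps], unfolded length_code]
  have "reaches h e (sem c' (sem c m))" using Seq.prems(3) by (simp only: sem.simps)
  then have "reaches h (b + code_length c) (sem c m)"
    using Seq.prems(2) by (intro Seq.IH(2)[OF l(2)]) simp_all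
  then show ?case
    using Seq.prems(2) by (intro Seq.IH(1)[OF l(1)]) simp_all
next
  case (When r c)
  have l: "loaded b ((True, r, r, Suc b, Suc b) # (False, r, r, e, b + 2) # code c (b + 2) e)"
    using When.prems(1) by simp
  have l': "loaded (b + 2) (code c (b + 2) e)"
    using loaded_Cons(2)[OF loaded_Cons(2)[OF l]] by simp
  have "reaches h (if m r = 0 then e else b + 2) m"
  proof (cases "m r = 0")
    case True
    then show ?thesis using When.prems(3) by simp
  next
    case False
    then have "reaches h e (sem c m)" using When.prems(3) by simp
    then have "reaches h (b + 2) m" using When.prems(2) by (intro When.IH[OF l']) simp_all
    then show ?thesis using False by simp
  qed
  then show ?case by (rule reaches_test[OF l])
next
  case (Loop r c)
  let ?body = "\<lambda>m. sem c (m(r := m r - 1))"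
  have l: "loaded b ((True, r, r, Suc b, Suc b) # (False, r, r, e, b + 2) #
      (False, r, r, b + 3, b + 3) # code c (b + 3) b)"
    using Loop.prems(1) by simp
  have l': "loaded (b + 2) ((False, r, r, b + 3, b + 3) # code c (b + 3) b)"
    using loaded_Cons(2)[OF loaded_Cons(2)[OF l]] by simp
  have l'': "loaded (b + 3) (code c (b + 3) b)"
    using loaded_Cons(2)[OF l'] by (simp add: numeral_3_eq_3)
  have "reaches h b m" if "m r = k" "reaches h e ((?body ^^ k) m)" for k m
    using that
  proof (induction k arbitrary: m)
    case 0
    then show ?case by (intro reaches_test[OF l]) simp
  next
    case (Suc k)
    have "?body m r = k"
      using Loop.prems(2) Suc.prems(1) by (simp add: sem_unchanged)
    moreover have "(?body ^^ Suc k) m = (?body ^^ k) (?body m)"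
      by (simp only: funpow_Suc_right o_apply)
    then have "reaches h e ((?body ^^ k) (?body m))"
      using Suc.prems(2) by (simp only:)
    ultimately have "reaches h b (?body m)" by (rule Suc.IH)
    moreover have "safe c" using Loop.prems(2) by simp
    ultimately have "reaches h (b + 3) (m(r := m r - 1))"
      by (intro Loop.IH[OF l''])
    then have "reaches h (b + 2) m"
      by (intro reaches_instr[OF loaded_Cons(1)[OF l'] refl]) (simp add: opv_def)
    then show ?case
      using Suc.prems(1) by (intro reaches_test[OF l]) simp
  qed
  from this[OF refl] show ?case using Loop.prems(3) by simp
qed

end

section \<open>Compilation of bounded evaluation\<close>

text \<open>\<open>search e t\<close> looks for the least \<open>i < t\<close> with \<open>e i = 1\<close>; the second component is 1 as long as
  \<open>e i \<ge> 2\<close> for all indices inspected so far.\<close>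

primrec search :: "(nat \<Rightarrow> nat) \<Rightarrow> nat \<Rightarrow> nat \<times> nat" where
  "search e 0 = (0, 1)"
| "search e (Suc i) = (if snd (search e i) = 0 then search e i
     else if e i = 0 then (0, 0) else if e i = 1 then (Suc i, 0) else (0, 1))"

text \<open>\<open>evalt f t xs\<close> is \<open>Suc y\<close> if \<open>f\<close> has value \<open>y\<close> and this can be found with all
  unbounded searches cut off at \<open>t\<close>, and 0 otherwise.\<close>

primrec evalt :: "recf \<Rightarrow> nat \<Rightarrow> nat list \<Rightarrow> nat" where
  "evalt Z = (\<lambda>t xs. 1)"
| "evalt S = (\<lambda>t xs. case xs of [] \<Rightarrow> 0 | x # _ \<Rightarrow> Suc (Suc x))"
| "evalt (Id i) = (\<lambda>t xs. if i < length xs then Suc (xs ! i) else 0)"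
| "evalt (Cn f gs) = (\<lambda>t xs. let ys = map (\<lambda>g. g t xs) (map evalt gs) in
     if 0 \<in> set ys then 0 else evalt f t (map (\<lambda>y. y - 1) ys))"
| "evalt (Pr f g) = (\<lambda>t xs. case xs of [] \<Rightarrow> 0 | x # xs \<Rightarrow>
     rec_nat (evalt f t xs) (\<lambda>i r. if r = 0 then 0 else evalt g t (i # (r - 1) # xs)) x)"
| "evalt (Mn f) = (\<lambda>t xs. fst (search (\<lambda>i. evalt f t (i # xs)) t))"

lemma search_running: "snd (search e t) \<noteq> 0 \<Longrightarrow> fst (search e t) = 0 \<and> snd (search e t) = 1 \<and> (\<forall>i<t. 2 \<le> e i)"
  by (induction t) (auto split: if_splits simp: less_Suc_eq)

lemma search_SucD:
  "fst (search e t) = Suc n \<Longrightarrow> e n = 1 \<and> (\<forall>i<n. 2 \<le> e i)"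
proof (induction t)
  case (Suc t)
  then show ?case using search_running[of e t] by (auto split: if_splits)
qed simp

lemma search_found:
  assumes "e n = 1" "\<And>i. i < n \<Longrightarrow> 2 \<le> e i"
  shows "n < t \<Longrightarrow> search e t = (Suc n, 0)"
proof (induction t)
  case (Suc t)
  have "search e k = (0, 1)" if "k \<le> n" for k
    using that
  proof (induction k)
    case (Suc k)
    then show ?case using assms(2)[of k] by auto
  qed simp
  then show ?case using Suc assms(1) by (cases "n = t") auto
qed simp

lemma evalt_sound: "evalt f t xs = Suc y \<Longrightarrow> eval f xs y"
proof (induction f arbitrary: xs y)
  case Z
  then show ?case by (auto intro: eval.intros)
next
  case S
  then show ?case by (auto intro: eval.intros split: list.splits)
next
  case (Id i)
  then show ?case by (auto intro: eval.intros split: if_splits)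
next
  case (Cn f gs)
  let ?ys = "map (\<lambda>g. evalt g t xs) gs"
  have ys: "0 \<notin> set ?ys" "evalt f t (map (\<lambda>y. y - 1) ?ys) = Suc y"
    using Cn.prems by (auto simp: Let_def comp_def split: if_splits)
  have "eval g xs (evalt g t xs - 1)" if "g \<in> set gs" for g
    using that ys(1) by (intro Cn.IH(2)) force+
  then have "list_all2 (\<lambda>g y. eval g xs y) gs (map (\<lambda>y. y - 1) ?ys)"
    by (auto simp: list_all2_conv_all_nth)
  then show ?case using Cn.IH(1)[OF ys(2)] by (rule eval.intros)
next
  case (Pr f g)
  obtain x xs' where xs: "xs = x # xs'" using Pr.prems by (cases xs) auto
  let ?h = "rec_nat (evalt f t xs') (\<lambda>i r. if r = 0 then 0 else evalt g t (i # (r - 1) # xs'))"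
  have "?h n = Suc y \<Longrightarrow> eval (Pr f g) (n # xs') y" for n y
  proof (induction n arbitrary: y)
    case 0
    then show ?case by (auto intro: eval.intros Pr.IH)
  next
    case (Suc n)
    then obtain r where r: "?h n = Suc r" by (cases "?h n") auto
    then show ?case using Suc Pr.IH(2) by (auto intro: eval.intros(6))
  qed
  then show ?case using Pr.prems xs by simp
next
  case (Mn f)
  then have "evalt f t (y # xs) = 1" and *: "\<forall>i<y. 2 \<le> evalt f t (i # xs)"
    using search_SucD[of "\<lambda>i. evalt f t (i # xs)" t y] by auto
  then have "eval f (y # xs) 0" by (intro Mn.IH) simp
  moreover have "\<exists>k. eval f (i # xs) (Suc k)" if "i < y" for i
  proof -
    have "evalt f t (i # xs) = Suc (Suc (evalt f t (i # xs) - 2))" using * that by force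
    then show ?thesis using Mn.IH by blast
  qed
  ultimately show ?case by (rule eval.intros)
qed

text \<open>Phrased with \<open>eventually\<close>, so that the finitely many bounds of the
  subcomputations combine without a monotonicity proof.\<close>

lemma evalt_complete: "eval f xs y \<Longrightarrow> eventually (\<lambda>t. evalt f t xs = Suc y) sequentially"
proof (induction rule: eval.induct)
  case (4 xs gs ys f z)
  have len: "length gs = length ys"
    and IH: "\<And>i. i < length ys \<Longrightarrow> eventually (\<lambda>t. evalt (gs ! i) t xs = Suc (ys ! i)) sequentially"
    using "4.IH"(1) by (auto simp: list_all2_conv_all_nth)
  have "eventually (\<lambda>t. \<forall>i\<in>{..<length ys}. evalt (gs ! i) t xs = Suc (ys ! i)) sequentially"
    using IH by (intro eventually_ball_finite) simp_all
  then show ?case using "4.IH"(2)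
  proof eventually_elim
    case (elim t)
    have "map (\<lambda>g. evalt g t xs) gs = map Suc ys"
      using len elim(1) by (intro nth_equalityI) simp_all
    then show ?case
      unfolding evalt.simps map_map comp_def by (simp add: Let_def comp_def image_iff elim(2))
  qed
next
  case (6 f g n xs r y)
  from "6.IH" show ?case by eventually_elim simp
next
  case (7 f n xs)
  from "7.IH"(2) obtain k where
    k: "\<And>m. m < n \<Longrightarrow> eventually (\<lambda>t. evalt f t (m # xs) = Suc (Suc (k m))) sequentially"
    by metis
  have "eventually (\<lambda>t. \<forall>m\<in>{..<n}. evalt f t (m # xs) = Suc (Suc (k m))) sequentially"
    using k by (intro eventually_ball_finite) simp_all
  then show ?case using "7.IH"(1) eventually_gt_at_top[of n]
  proof eventually_elim
    case (elim t)
    have "search (\<lambda>i. evalt f t (i # xs)) t = (Suc n, 0)"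
      using elim by (intro search_found) simp_all
    then show ?case by simp
  qed
qed simp_all

text \<open>An instruction can only write a source plus or minus one. Constants come from register
  1, which stays 0, as truncated subtraction gives 0 again.\<close>

abbreviation clear :: "nat \<Rightarrow> com" where "clear r \<equiv> Upd False r 1"
abbreviation set_one :: "nat \<Rightarrow> com" where "set_one r \<equiv> Upd True r 1"
abbreviation copy :: "nat \<Rightarrow> nat \<Rightarrow> com" where "copy d s \<equiv> Seq (Upd True d s) (Upd False d d)"

text \<open>The list contains code generators instead of functions, which lets
  \<open>compile\<close> recurse through \<open>map compile gs\<close>.\<close>

primrec eval_args :: "(nat list \<Rightarrow> nat \<Rightarrow> nat \<Rightarrow> com) list \<Rightarrow> nat list \<Rightarrow> nat \<Rightarrow> nat \<Rightarrow> com \<Rightarrow> com" where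
  "eval_args [] as i k c = c"
| "eval_args (g # gs) as i k c = Seq (g as i k) (eval_args gs as (Suc i) k c)"

text \<open>Values arrive shifted by one, with 0 for undefined: \<open>whens\<close> skips the call
  if an argument is undefined, and \<open>decs\<close> removes the shift.\<close>

definition whens :: "nat list \<Rightarrow> com \<Rightarrow> com" where
  "whens rs c = foldr When rs c"

definition decs :: "nat list \<Rightarrow> com \<Rightarrow> com" where
  "decs rs c = foldr (\<lambda>r. Seq (Upd False r r)) rs c"

text \<open>\<open>compile f as r k\<close> leaves in register \<open>r\<close> the value of \<open>evalt f\<close> on the registers \<open>as\<close>, using
  the registers from \<open>k\<close> on as scratch space. Register 1 is constantly zero and register 2 holds the
  bound for the searches.\<close>

primrec compile :: "recf \<Rightarrow> nat list \<Rightarrow> nat \<Rightarrow> nat \<Rightarrow> com" where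
  "compile Z = (\<lambda>as r k. set_one r)"
| "compile S = (\<lambda>as r k. case as of [] \<Rightarrow> clear r | a # _ \<Rightarrow> Seq (Upd True r a) (Upd True r r))"
| "compile (Id i) = (\<lambda>as r k. if i < length as then Upd True r (as ! i) else clear r)"
| "compile (Cn f gs) = (\<lambda>as r k. let n = length gs; ys = [k..<k + n] in
     Seq (clear r) (eval_args (map compile gs) as k (k + n)
       (whens ys (decs ys (compile f ys r (k + n))))))"
| "compile (Pr f g) = (\<lambda>as r k. case as of [] \<Rightarrow> clear r | a # as \<Rightarrow>
     Seq (Seq (compile f as r k) (Seq (clear k) (copy (k + 1) a)))
       (Loop (k + 1) (Seq
         (When r (Seq (Upd False (k + 2) r)
           (Seq (compile g (k # (k + 2) # as) (k + 3) (k + 4)) (copy r (k + 3)))))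
         (Upd True k k))))"
| "compile (Mn f) = (\<lambda>as r k.
     Seq (Seq (clear r) (Seq (clear k) (Seq (set_one (k + 2)) (copy (k + 1) 2))))
       (Loop (k + 1) (Seq
         (When (k + 2) (Seq (compile f (k # as) (k + 3) (k + 4)) (Seq (clear (k + 2))
           (When (k + 3) (Seq (Upd False (k + 4) (k + 3)) (Seq (Upd True r k)
             (When (k + 4) (Seq (clear r) (set_one (k + 2))))))))))
         (Upd True k k))))"

lemma writes_whens [simp]: "writes (whens rs c) = writes c"
  by (induction rs) (auto simp: whens_def)

lemma writes_decs [simp]: "writes (decs rs c) = set rs \<union> writes c"
  by (induction rs) (auto simp: decs_def)

lemma safe_whens [simp]: "safe (whens rs c) = safe c"
  by (induction rs) (auto simp: whens_def)

lemma safe_decs [simp]: "safe (decs rs c) = safe c"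
  by (induction rs) (auto simp: decs_def)

lemma sem_whens: "sem (whens rs c) m = (if 0 \<in> m ` set rs then m else sem c m)"
  by (induction rs) (auto simp: whens_def)

lemma sem_decs: "distinct rs \<Longrightarrow> sem (decs rs c) m = sem c (\<lambda>x. if x \<in> set rs then m x - 1 else m x)"
proof (induction rs arbitrary: m)
  case (Cons r rs)
  have "(\<lambda>x. if x \<in> set rs then (m(r := m r - 1)) x - 1 else (m(r := m r - 1)) x)
      = (\<lambda>x. if x \<in> set (r # rs) then m x - 1 else m x)"
    using Cons.prems by (auto simp: fun_eq_iff)
  moreover have "sem (decs (r # rs) c) m = sem (decs rs c) (m(r := m r - 1))"
    by (simp add: decs_def opv_def)
  ultimately show ?case using Cons by (simp only: distinct.simps)
qed (simp add: decs_def)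

lemma writes_eval_args:
  "(\<And>g j. g \<in> set gs \<Longrightarrow> writes (g as j k) \<subseteq> insert j {k..}) \<Longrightarrow>
    writes (eval_args gs as i k c) \<subseteq> {i..<i + length gs} \<union> {k..} \<union> writes c"
proof (induction gs arbitrary: i)
  case (Cons g gs)
  have "writes (eval_args gs as (Suc i) k c) \<subseteq> {Suc i..<Suc i + length gs} \<union> {k..} \<union> writes c"
    using Cons.prems by (intro Cons.IH) simp
  moreover have "writes (g as i k) \<subseteq> insert i {k..}" using Cons.prems by simp
  ultimately show ?case by fastforce
qed simp

text \<open>Both the safety of the loops and the survival of the arguments rest on this
  confinement.\<close>

lemma writes_compile: "writes (compile f as r k) \<subseteq> insert r {k..}"
proof (induction f arbitrary: as r k)
  case (Cn f gs)
  have "writes (eval_args (map compile gs) as k (k + length gs) c) \<subseteq> {k..} \<union> writes c" for c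
    using writes_eval_args[of "map compile gs" as "k + length gs" k c] Cn.IH(2) by fastforce
  then show ?case
    using Cn.IH(1)[of "[k..<k + length gs]" r "k + length gs"] by (fastforce simp: Let_def)
next
  case (Pr f g)
  show ?case
  proof (cases as)
    case (Cons a as')
    then show ?thesis
      using Pr.IH(1)[of as' r k] Pr.IH(2)[of "k # (k + 2) # as'" "k + 3" "k + 4"] by fastforce
  qed simp
next
  case (Mn f)
  then show ?case using Mn.IH[of "k # as" "k + 3" "k + 4"] by fastforce
qed (auto split: list.splits)

lemma safe_eval_args:
  "safe c \<Longrightarrow> (\<And>g j. g \<in> set gs \<Longrightarrow> i \<le> j \<Longrightarrow> j < i + length gs \<Longrightarrow> safe (g as j k)) \<Longrightarrow> safe (eval_args gs as i k c)"
proof (induction gs arbitrary: i)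
  case (Cons g gs)
  have "safe (eval_args gs as (Suc i) k c)" using Cons.prems by (intro Cons.IH) auto
  then show ?case using Cons.prems by simp
qed simp

lemma safe_compile: "r < k \<Longrightarrow> safe (compile f as r k)"
proof (induction f arbitrary: as r k)
  case (Cn f gs)
  then show ?case by (auto simp: Let_def intro!: safe_eval_args)
next
  case (Pr f g)
  show ?case
  proof (cases as)
    case (Cons a as')
    then show ?thesis
      using Pr writes_compile[of g "k # (k + 2) # as'" "k + 3" "k + 4"] by fastforce
  qed simp
next
  case (Mn f)
  then show ?case using writes_compile[of f "k # as" "k + 3" "k + 4"] by fastforce
qed (auto split: list.splits)

lemma sem_compile_unchanged: "x < k \<Longrightarrow> x \<noteq> r \<Longrightarrow> sem (compile f as r k) m x = m x"
  using writes_compile[of f as r k] by (intro sem_unchanged) auto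

lemma sem_eval_args:
  assumes "\<And>g j m. g \<in> set gs \<Longrightarrow> j < k \<Longrightarrow> j \<notin> set as \<Longrightarrow> 2 < j \<Longrightarrow> m 1 = 0 \<Longrightarrow>
      sem (compile g as j k) m j = evalt g (m 2) (map m as)"
    and "set as \<subseteq> {..<i}" "i + length gs \<le> k" "2 < i" "m 1 = 0"
  shows "\<exists>m'. sem (eval_args (map compile gs) as i k c) m = sem c m' \<and> (\<forall>x<i. m' x = m x) \<and>
    (\<forall>j<length gs. m' (i + j) = evalt (gs ! j) (m 2) (map m as))"
  using assms
proof (induction gs arbitrary: i m)
  case (Cons g gs)
  let ?m = "sem (compile g as i k) m"
  have g: "?m i = evalt g (m 2) (map m as)"
    using Cons.prems by (intro Cons.prems(1)) auto
  have same: "?m x = m x" if "x < i" for x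
    using that Cons.prems(3) by (intro sem_compile_unchanged) auto
  then have args: "map ?m as = map m as" and "?m 1 = 0" "?m 2 = m 2"
    using Cons.prems by auto
  have "\<exists>m'. sem (eval_args (map compile gs) as (Suc i) k c) ?m = sem c m' \<and> (\<forall>x<Suc i. m' x = ?m x) \<and>
    (\<forall>j<length gs. m' (Suc i + j) = evalt (gs ! j) (?m 2) (map ?m as))"
  proof (rule Cons.IH)
    show "set as \<subseteq> {..<Suc i}" using Cons.prems(2) by auto
  qed (use Cons.prems \<open>?m 1 = 0\<close> in auto)
  then obtain m' where m': "sem (eval_args (map compile gs) as (Suc i) k c) ?m = sem c m'"
    "\<And>x. x < Suc i \<Longrightarrow> m' x = ?m x"
    "\<And>j. j < length gs \<Longrightarrow> m' (Suc i + j) = evalt (gs ! j) (m 2) (map m as)"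
    unfolding args \<open>?m 2 = m 2\<close> by blast
  have "m' (i + j) = evalt ((g # gs) ! j) (m 2) (map m as)" if "j < length (g # gs)" for j
    using that m'(2)[of i] m'(3)[of "j - 1"] g by (cases j) auto
  then show ?case
    using m'(1,2) same by (intro exI[of _ m']) auto
qed auto

lemma sem_compile_Cn:
  assumes f: "\<And>m as. set as \<subseteq> {..<k + length gs} \<Longrightarrow> r \<notin> set as \<Longrightarrow> m 1 = 0 \<Longrightarrow>
      sem (compile f as r (k + length gs)) m r = evalt f (m 2) (map m as)"
    and gs: "\<And>g j m. g \<in> set gs \<Longrightarrow> j < k + length gs \<Longrightarrow> j \<notin> set as \<Longrightarrow> 2 < j \<Longrightarrow> m 1 = 0 \<Longrightarrow>
      sem (compile g as j (k + length gs)) m j = evalt g (m 2) (map m as)"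
    and r: "2 < r" "r < k" "set as \<subseteq> {..<k}" "r \<notin> set as" "m 1 = 0"
  shows "sem (compile (Cn f gs) as r k) m r = evalt (Cn f gs) (m 2) (map m as)"
proof -
  let ?n = "length gs"
  define m1 where "m1 = m(r := 0)"
  define c where "c = whens [k..<k + ?n] (decs [k..<k + ?n] (compile f [k..<k + ?n] r (k + ?n)))"
  have m1: "map m1 as = map m as" "m1 1 = 0" "m1 2 = m 2" "m1 r = 0"
    using r by (auto simp: m1_def)
  have "\<exists>m'. sem (eval_args (map compile gs) as k (k + ?n) c) m1 = sem c m' \<and> (\<forall>x<k. m' x = m1 x) \<and>
    (\<forall>j<length gs. m' (k + j) = evalt (gs ! j) (m1 2) (map m1 as))"
    using r m1(2) by (intro sem_eval_args gs) auto
  then obtain m' where m': "sem (eval_args (map compile gs) as k (k + ?n) c) m1 = sem c m'"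
    "\<And>x. x < k \<Longrightarrow> m' x = m1 x"
    "\<And>j. j < length gs \<Longrightarrow> m' (k + j) = evalt (gs ! j) (m 2) (map m as)"
    unfolding m1 by blast
  have vals: "map m' [k..<k + ?n] = map (\<lambda>g. g (m 2) (map m as)) (map evalt gs)"
    using m'(3) by (intro nth_equalityI) auto
  have sem: "sem (compile (Cn f gs) as r k) m = sem c m'"
    using m'(1) r(5) by (simp add: c_def m1_def opv_def Let_def)
  show ?thesis
  proof (cases "0 \<in> m' ` {k..<k + ?n}")
    case True
    then have "sem c m' r = 0"
      using m'(2)[of r] m1 r by (simp add: c_def sem_whens)
    moreover have "0 \<in> set (map (\<lambda>g. g (m 2) (map m as)) (map evalt gs))"
      using True unfolding vals[symmetric] by simp
    ultimately show ?thesis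
      unfolding sem evalt.simps Let_def by (simp only: if_True)
  next
    case False
    let ?m = "\<lambda>x. if x \<in> {k..<k + ?n} then m' x - 1 else m' x"
    have "sem c m' r = sem (compile f [k..<k + ?n] r (k + ?n)) ?m r"
      using False by (simp add: c_def sem_whens sem_decs)
    also have "\<dots> = evalt f (?m 2) (map ?m [k..<k + ?n])"
      using r m'(2)[of 1] m1 by (intro f) auto
    also have "?m 2 = m 2" using r m'(2)[of 2] m1 by simp
    also have "map ?m [k..<k + ?n] = map (\<lambda>y. y - 1) (map m' [k..<k + ?n])" by simp
    finally have "sem c m' r = evalt f (m 2) (map (\<lambda>y. y - 1) (map (\<lambda>g. g (m 2) (map m as)) (map evalt gs)))"
      unfolding vals .
    moreover have "0 \<notin> set (map (\<lambda>g. g (m 2) (map m as)) (map evalt gs))"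
      using False unfolding vals[symmetric] by simp
    ultimately show ?thesis
      unfolding sem evalt.simps Let_def by (simp only: if_False)
  qed
qed

lemma sem_compile_Pr:
  assumes f: "\<And>m. m 1 = 0 \<Longrightarrow> sem (compile f as r k) m r = evalt f (m 2) (map m as)"
    and g: "\<And>m. m 1 = 0 \<Longrightarrow> sem (compile g (k # (k + 2) # as) (k + 3) (k + 4)) m (k + 3)
      = evalt g (m 2) (m k # m (k + 2) # map m as)"
    and r: "2 < r" "r < k" "set (a # as) \<subseteq> {..<k}" "r \<notin> set (a # as)" "m 1 = 0"
  shows "sem (compile (Pr f g) (a # as) r k) m r = evalt (Pr f g) (m 2) (map m (a # as))"
proof -
  let ?t = "m 2" and ?xs = "map m as"
  let ?h = "rec_nat (evalt f ?t ?xs) (\<lambda>i y. if y = 0 then 0 else evalt g ?t (i # (y - 1) # ?xs))"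
  define body where "body = Seq
         (When r (Seq (Upd False (k + 2) r)
           (Seq (compile g (k # (k + 2) # as) (k + 3) (k + 4)) (copy r (k + 3)))))
         (Upd True k k)"
  define m0 where "m0 = sem (Seq (compile f as r k) (Seq (clear k) (copy (k + 1) a))) m"
  have unch: "sem (compile f as r k) m x = m x" if "x < k" "x \<noteq> r" for x
    using that by (rule sem_compile_unchanged)
  have m0: "m0 x = m x" if "x < k" "x \<noteq> r" for x
    using that unch by (simp add: m0_def)
  have m0': "m0 r = evalt f ?t ?xs" "m0 k = 0" "m0 (k + 1) = m a"
    using r f[of m] unch[of a] unch[of 1] by (auto simp: m0_def opv_def)
  define step where "step = (\<lambda>m. sem body (m(k + 1 := m (k + 1) - 1)))"
  define M where "M = (\<lambda>n. (step ^^ n) m0)"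
  have M: "M 0 = m0" "\<And>n. M (Suc n) = sem body ((M n)(k + 1 := M n (k + 1) - 1))"
    by (simp_all add: M_def step_def)
  \<comment> \<open>Loop invariant after \<open>n\<close> passes: \<open>k\<close> counts the passes
    and \<open>r\<close> holds the shifted value of the recursion, which stays 0 once it is
    undefined.\<close>
  have inv: "(\<forall>x<k. x \<noteq> r \<longrightarrow> M n x = m x) \<and> M n r = ?h n \<and> M n k = n" for n
  proof (induction n)
    case 0
    then show ?case using m0 m0' M(1) by simp
  next
    case (Suc n)
    define m1 where "m1 = M n"
    define m2 where "m2 = m1(k + 1 := m1 (k + 1) - 1)"
    define m3 where "m3 = m2(k + 2 := m2 r - 1)"
    define m4 where "m4 = sem (compile g (k # (k + 2) # as) (k + 3) (k + 4)) m3"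
    have step: "M (Suc n) = sem body m2"
      unfolding M(2) m1_def m2_def ..
    have m1: "\<And>x. x < k \<Longrightarrow> x \<noteq> r \<Longrightarrow> m1 x = m x" "m1 r = ?h n" "m1 k = n"
      using Suc by (auto simp: m1_def)
    have m2: "\<And>x. x < k \<Longrightarrow> x \<noteq> r \<Longrightarrow> m2 x = m x" "m2 r = ?h n" "m2 k = n"
      using m1 r by (auto simp: m2_def)
    have m3: "\<And>x. x < k \<Longrightarrow> x \<noteq> r \<Longrightarrow> m3 x = m x" "m3 (k + 2) = ?h n - 1" "m3 k = n"
      using m2 r by (auto simp: m3_def)
    have m4_unch: "m4 x = m3 x" if "x < k + 3" for x
      unfolding m4_def using that by (intro sem_compile_unchanged) auto
    have m3': "m3 1 = 0" "m3 2 = ?t" "map m3 as = ?xs"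
      using m3(1)[of 1] m3(1)[of 2] m3(1) r by auto
    have m4: "m4 (k + 3) = evalt g ?t (n # (?h n - 1) # ?xs)"
      unfolding m4_def g[of m3, OF m3'(1)] m3'(2,3) m3(2,3) ..
    have body: "sem body m2 = (if ?h n = 0 then m2 else m4(r := m4 (k + 3)))(k := Suc n)"
    proof (cases "?h n = 0")
      case True
      then show ?thesis using m2 by (simp add: body_def opv_def)
    next
      case False
      then have "sem body m2 = (let m' = sem (copy r (k + 3)) m4 in m'(k := Suc (m' k)))"
        using m2 by (simp add: body_def opv_def m4_def m3_def)
      also have "sem (copy r (k + 3)) m4 = m4(r := m4 (k + 3))"
        by (simp add: opv_def)
      finally show ?thesis using False m4_unch[of k] m3(3) r by (simp add: Let_def fun_eq_iff)
    qed
    have "?h (Suc n) = (if ?h n = 0 then 0 else m4 (k + 3))"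
      unfolding m4 by simp
    then show ?case
      unfolding step body using m2 m4_unch m3 r by auto
  qed
  have "sem (compile (Pr f g) (a # as) r k) m = M (m0 (k + 1))"
    by (simp only: M_def step_def body_def m0_def compile.simps list.case sem.simps)
  also have "m0 (k + 1) = m a" by (rule m0')
  finally have "sem (compile (Pr f g) (a # as) r k) m r = ?h (m a)"
    using inv by simp
  then show ?thesis by simp
qed

text \<open>A loop cannot be left early, so the flag in \<open>k + 2\<close> switches its body off.
  For a defined value the body provisionally stores the successor of the candidate in
  \<open>r\<close>, and withdraws it and restores the flag if the value is positive.\<close>

lemma sem_compile_Mn:
  assumes f: "\<And>m. m 1 = 0 \<Longrightarrow> sem (compile f (k # as) (k + 3) (k + 4)) m (k + 3)
      = evalt f (m 2) (m k # map m as)"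
    and r: "2 < r" "r < k" "set as \<subseteq> {..<k}" "r \<notin> set as" "m 1 = 0"
  shows "sem (compile (Mn f) as r k) m r = evalt (Mn f) (m 2) (map m as)"
proof -
  let ?t = "m 2" and ?xs = "map m as"
  let ?s = "search (\<lambda>i. evalt f ?t (i # ?xs))"
  define body where "body = Seq
         (When (k + 2) (Seq (compile f (k # as) (k + 3) (k + 4)) (Seq (clear (k + 2))
           (When (k + 3) (Seq (Upd False (k + 4) (k + 3)) (Seq (Upd True r k)
             (When (k + 4) (Seq (clear r) (set_one (k + 2))))))))))
         (Upd True k k)"
  define m0 where "m0 = sem (Seq (clear r) (Seq (clear k) (Seq (set_one (k + 2)) (copy (k + 1) 2)))) m"
  have m0: "m0 x = m x" if "x < k" "x \<noteq> r" for x
    using that by (simp add: m0_def)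
  have m0': "m0 r = 0" "m0 k = 0" "m0 (k + 1) = ?t" "m0 (k + 2) = 1"
    using r by (auto simp: m0_def opv_def)
  define step where "step = (\<lambda>m. sem body (m(k + 1 := m (k + 1) - 1)))"
  define M where "M = (\<lambda>n. (step ^^ n) m0)"
  have M: "M 0 = m0" "\<And>n. M (Suc n) = sem body ((M n)(k + 1 := M n (k + 1) - 1))"
    by (simp_all add: M_def step_def)
  have inv: "(\<forall>x<k. x \<noteq> r \<longrightarrow> M n x = m x) \<and> M n r = fst (?s n) \<and>
    M n (k + 2) = snd (?s n) \<and> M n k = n" for n
  proof (induction n)
    case 0
    then show ?case using m0 m0' M(1) by simp
  next
    case (Suc n)
    define m1 where "m1 = M n"
    define m2 where "m2 = m1(k + 1 := m1 (k + 1) - 1)"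
    define m4 where "m4 = sem (compile f (k # as) (k + 3) (k + 4)) m2"
    have step: "M (Suc n) = sem body m2"
      unfolding M(2) m1_def m2_def ..
    have m1: "\<And>x. x < k \<Longrightarrow> x \<noteq> r \<Longrightarrow> m1 x = m x" "m1 r = fst (?s n)" "m1 (k + 2) = snd (?s n)" "m1 k = n"
      using Suc by (auto simp: m1_def)
    have m2: "\<And>x. x < k \<Longrightarrow> x \<noteq> r \<Longrightarrow> m2 x = m x" "m2 r = fst (?s n)" "m2 (k + 2) = snd (?s n)" "m2 k = n"
      using m1 r by (auto simp: m2_def)
    have m4_unch: "m4 x = m2 x" if "x < k + 3" for x
      unfolding m4_def using that by (intro sem_compile_unchanged) auto
    have m2': "m2 1 = 0" "m2 2 = ?t" "map m2 as = ?xs"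
      using m2(1)[of 1] m2(1)[of 2] m2(1) r by auto
    have m4: "m4 (k + 3) = evalt f ?t (n # ?xs)"
      unfolding m4_def f[of m2, OF m2'(1)] m2'(2,3) m2(4) ..
    have m4': "\<And>x. x < k \<Longrightarrow> x \<noteq> r \<Longrightarrow> m4 x = m x" "m4 r = fst (?s n)" "m4 k = n" "m4 1 = 0"
      using m4_unch m2 r by auto
    show ?case
    proof (cases "snd (?s n) = 0")
      case True
      then have "sem body m2 = m2(k := Suc n)"
        using m2 by (simp add: body_def opv_def)
      then show ?thesis unfolding step using m2 r True by auto
    next
      case False
      then have s: "fst (?s n) = 0" "?s n = (0, 1)"
        using search_running by (metis, metis prod.collapse)
      have body: "sem body m2 = sem (Upd True k k) (sem (When (k + 3) (Seq (Upd False (k + 4) (k + 3)) (Seq (Upd True r k)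
             (When (k + 4) (Seq (clear r) (set_one (k + 2))))))) (m4(k + 2 := 0)))"
        using False m2 m4' by (simp add: body_def opv_def m4_def)
      \<comment> \<open>Because of the shift, the cases are: undefined, value zero, positive
        value.\<close>
      consider "m4 (k + 3) = 0" | "m4 (k + 3) = 1" | "2 \<le> m4 (k + 3)" by linarith
      then show ?thesis
        unfolding step body using r s False m4 m4' by cases (auto simp: opv_def)
    qed
  qed
  have "sem (compile (Mn f) as r k) m = M (m0 (k + 1))"
    by (simp only: M_def step_def body_def m0_def compile.simps list.case sem.simps)
  also have "m0 (k + 1) = ?t" by (rule m0')
  finally show ?thesis using inv by simp
qed

lemma sem_compile:
  assumes "2 < r" "r < k" "set as \<subseteq> {..<k}" "r \<notin> set as" "m 1 = 0"
  shows "sem (compile f as r k) m r = evalt f (m 2) (map m as)"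
  using assms
proof (induction f arbitrary: as r k m)
  case (Cn f gs)
  show ?case
  proof (rule sem_compile_Cn)
    show "sem (compile f as' r (k + length gs)) m' r = evalt f (m' 2) (map m' as')"
      if "set as' \<subseteq> {..<k + length gs}" "r \<notin> set as'" "m' 1 = 0" for m' as'
      using that Cn.prems by (intro Cn.IH(1)) auto
    show "sem (compile g as j (k + length gs)) m' j = evalt g (m' 2) (map m' as)"
      if "g \<in> set gs" "j < k + length gs" "j \<notin> set as" "2 < j" "m' 1 = 0" for g j m'
      using that Cn.prems by (intro Cn.IH(2)) auto
  qed (use Cn.prems in auto)
next
  case (Pr f g)
  show ?case
  proof (cases as)
    case Nil
    then show ?thesis using Pr.prems by (simp add: opv_def)
  next
    case (Cons a as')
    show ?thesis
      unfolding Cons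
    proof (rule sem_compile_Pr)
      show "sem (compile f as' r k) m' r = evalt f (m' 2) (map m' as')" if "m' 1 = 0" for m'
        using that Pr.prems Cons by (intro Pr.IH(1)) auto
      have "sem (compile g (k # (k + 2) # as') (k + 3) (k + 4)) m' (k + 3)
          = evalt g (m' 2) (map m' (k # (k + 2) # as'))" if "m' 1 = 0" for m'
        using that Pr.prems Cons by (intro Pr.IH(2)) auto
      then show "sem (compile g (k # (k + 2) # as') (k + 3) (k + 4)) m' (k + 3)
          = evalt g (m' 2) (m' k # m' (k + 2) # map m' as')" if "m' 1 = 0" for m'
        using that by simp
    qed (use Pr.prems Cons in auto)
  qed
next
  case (Mn f)
  show ?case
  proof (rule sem_compile_Mn)
    have "sem (compile f (k # as) (k + 3) (k + 4)) m' (k + 3) = evalt f (m' 2) (map m' (k # as))"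
      if "m' 1 = 0" for m'
      using that Mn.prems by (intro Mn.IH) auto
    then show "sem (compile f (k # as) (k + 3) (k + 4)) m' (k + 3) = evalt f (m' 2) (m' k # map m' as)"
      if "m' 1 = 0" for m'
      using that by simp
  qed (use Mn.prems in auto)
qed (auto simp: opv_def split: list.splits)

section \<open>The machine that runs two searches in rounds of growing bounds\<close>

definition round :: "recf \<Rightarrow> recf \<Rightarrow> com" where
  "round f g = Seq (Seq (compile f [0] 3 5) (compile g [0] 4 5)) (Upd True 2 2)"

lemma sem_round:
  assumes "m 1 = 0"
  shows "sem (round f g) m 0 = m 0" "sem (round f g) m 1 = 0" "sem (round f g) m 2 = Suc (m 2)"
    "sem (round f g) m 3 = evalt f (m 2) [m 0]" "sem (round f g) m 4 = evalt g (m 2) [m 0]"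
proof -
  define m1 where "m1 = sem (compile f [0] 3 5) m"
  define m2 where "m2 = sem (compile g [0] 4 5) m1"
  have m1: "\<And>x. x < 5 \<Longrightarrow> x \<noteq> 3 \<Longrightarrow> m1 x = m x" "m1 3 = evalt f (m 2) [m 0]"
    using sem_compile_unchanged[of _ 5 3 f "[0]" m] sem_compile[of 3 5 "[0]" m f] assms
    by (simp_all add: m1_def)
  have m2: "\<And>x. x < 5 \<Longrightarrow> x \<noteq> 4 \<Longrightarrow> m2 x = m1 x" "m2 4 = evalt g (m1 2) [m1 0]"
    using sem_compile_unchanged[of _ 5 4 g "[0]" m1] sem_compile[of 4 5 "[0]" m1 g] assms m1(1)[of 1]
    by (simp_all add: m2_def)
  have "sem (round f g) m = m2(2 := Suc (m2 2))"
    by (simp add: round_def m1_def m2_def opv_def)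
  then show "sem (round f g) m 0 = m 0" "sem (round f g) m 1 = 0" "sem (round f g) m 2 = Suc (m 2)"
    "sem (round f g) m 3 = evalt f (m 2) [m 0]" "sem (round f g) m 4 = evalt g (m 2) [m 0]"
    using m1 m2 assms by simp_all
qed

lemma query_exists:
  "\<exists>\<phi> \<psi> \<Gamma> \<delta>. \<forall>n. let s = (\<phi> # replicate n \<psi> @ \<Gamma> \<turnstile> \<delta>) in
    ((\<exists>y. eval f [n] y) \<and> (\<nexists>y. eval g [n] y) \<longrightarrow> s \<in> ACT) \<and>
    ((\<exists>y. eval g [n] y) \<and> (\<nexists>y. eval f [n] y) \<longrightarrow> s \<notin> ACT_omega_D)"
proof -
  define c where "c = round f g"
  define l where "l = code_length c"
  \<comment> \<open>Registers 0 to 4 hold the input, zero, the bound and the two results, so at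
    least five must be initialised.\<close>
  define R where "R = max 5 (reg_bound c)"
  \<comment> \<open>Two zero tests follow the round: a result in register 3 accepts, one in register
    4 rejects, and otherwise the next round starts. With four instructions here, \<open>acc\<close>
    is \<open>R + l + 4\<close> and \<open>rej\<close> is \<open>R + l + 5\<close>.\<close>
  define branch :: "instr list" where "branch = [(True, 3, 3, R + l + 1, R + l + 1), (False, 3, 3, R + l + 2, R + l + 4),
     (True, 4, 4, R + l + 3, R + l + 3), (False, 4, 4, R, R + l + 5)]"
  define P where "P = code c R (R + l) @ branch"
  have len: "length P = l + 4" by (simp add: P_def branch_def l_def)
  have "s < R \<and> R \<le> a \<and> a \<le> Suc (R + length P) \<and> R \<le> b \<and> b \<le> Suc (R + length P)"
    if "(i, d, s, a, b) \<in> set P" for i d s a b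
  proof -
    consider "(i, d, s, a, b) \<in> set (code c R (R + l))" | "(i, d, s, a, b) \<in> set branch"
      using \<open>(i, d, s, a, b) \<in> set P\<close> by (auto simp: P_def)
    then show ?thesis
    proof cases
      case 1
      have "s < reg_bound c \<and> R \<le> a \<and> a \<le> R + l \<and> R \<le> b \<and> b \<le> R + l"
        by (rule code_bounded[OF 1]) (simp_all add: l_def)
      moreover have "reg_bound c \<le> R" by (simp add: R_def)
      ultimately show ?thesis using len by linarith
    next
      case 2
      moreover have "5 \<le> R" by (simp add: R_def)
      ultimately show ?thesis using len by (auto simp: branch_def)
    qed
  qed
  then interpret machine R P
    by unfold_locales (simp_all add: R_def)
  have acc: "acc = R + l + 4" and rej: "rej = R + l + 5"
    using len by (simp_all add: acc_def rej_def)
  have "loaded R (code c R (R + l) @ branch)"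
    unfolding loaded_def by (intro exI[of _ "[]"]) (simp add: P_def)
  note loaded = loaded_append[OF this]
  have l1: "loaded (R + l) ((True, 3, 3, Suc (R + l), Suc (R + l)) # (False, 3, 3, R + l + 2, acc) #
     [(True, 4, 4, R + l + 3, R + l + 3), (False, 4, 4, R, rej)])"
    using loaded(2) by (simp add: branch_def acc rej l_def)
  have l2: "loaded (R + l + 2) ((True, 4, 4, Suc (R + l + 2), Suc (R + l + 2)) # (False, 4, 4, R, rej) # [])"
    using loaded_Cons(2)[OF loaded_Cons(2)[OF l1]] by (simp add: numeral_3_eq_3)
  have c: "reaches h R m" if "reaches h (if m' 3 = 0 then if m' 4 = 0 then R else rej else acc) m'"
    "m' = sem c m" for h m m'
  proof -
    have "reaches h (R + l) m'"
    proof (cases "m' 3 = 0")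
      case True
      then have "reaches h (R + l + 2) m'"
        using that(1) by (intro reaches_test[OF l2]) simp
      then show ?thesis using True by (intro reaches_test[OF l1]) simp
    next
      case False
      then show ?thesis using that(1) by (intro reaches_test[OF l1]) simp
    qed
    moreover have "safe c" by (simp add: c_def round_def safe_compile)
    ultimately show ?thesis
      using reaches_code[OF loaded(1)] that(2) by blast
  qed
  \<comment> \<open>\<open>t\<close> is a bound at which one search succeeds. A round without
    success has another bound, so the distance to \<open>t\<close> decreases. As the opposite search
    never succeeds, any earlier success also leads to \<open>h\<close>.\<close>
  have loop: "reaches h R m"
    if "m 1 = 0" "evalt f t [m 0] \<noteq> 0 \<or> evalt g t [m 0] \<noteq> 0" "m 2 \<le> t"
      "h = acc \<and> (\<forall>i. evalt g i [m 0] = 0) \<or> h = rej \<and> (\<forall>i. evalt f i [m 0] = 0)" for h m t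
    using that
  proof (induction "t - m 2" arbitrary: m rule: less_induct)
    case less
    let ?m = "sem c m"
    note m = sem_round[of m f g, OF less.prems(1), folded c_def]
    have "reaches h (if ?m 3 = 0 then if ?m 4 = 0 then R else rej else acc) ?m"
    proof (cases "?m 3 = 0 \<and> ?m 4 = 0")
      case True
      then have "m 2 \<noteq> t" using less.prems(2) m by auto
      then have "reaches h R ?m"
        using less.prems m by (intro less.hyps) auto
      then show ?thesis using True by simp
    next
      case False
      then show ?thesis using less.prems(4) m by (auto intro: halt)
    qed
    then show ?case by (rule c) simp
  qed
  have eval_iff: "(\<exists>y. eval f' [n] y) \<longleftrightarrow> (\<exists>t. evalt f' t [n] \<noteq> 0)" for f' n
  proof
    assume "\<exists>y. eval f' [n] y"
    then obtain y where "eventually (\<lambda>t. evalt f' t [n] = Suc y) sequentially"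
      using evalt_complete by blast
    then obtain t where "evalt f' t [n] = Suc y"
      using eventually_happens by force
    then show "\<exists>t. evalt f' t [n] \<noteq> 0" by (metis nat.distinct(1))
  next
    assume "\<exists>t. evalt f' t [n] \<noteq> 0"
    then show "\<exists>y. eval f' [n] y" using evalt_sound by (metis not0_implies_Suc)
  qed
  have "query n \<in> ACT" if ex: "\<exists>y. eval f [n] y" and nex: "\<nexists>y. eval g [n] y" for n
  proof (rule query_in_ACT)
    obtain t where t: "evalt f t [n] \<noteq> 0" using ex unfolding eval_iff by blast
    have "\<forall>i. evalt g i [n] = 0" using nex unfolding eval_iff by blast
    then show "reaches acc R (\<lambda>s. if s = 0 then n else 0)"
      using t by (intro loop[of _ t]) simp_all
  qed
  moreover have "query n \<notin> ACT_omega_D" if ex: "\<exists>y. eval g [n] y" and nex: "\<nexists>y. eval f [n] y" for n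
  proof (rule query_not_in_ACT_omega_D)
    obtain t where t: "evalt g t [n] \<noteq> 0" using ex unfolding eval_iff by blast
    have "\<forall>i. evalt f i [n] = 0" using nex unfolding eval_iff by blast
    then show "reaches rej R (\<lambda>s. if s = 0 then n else 0)"
      using t by (intro loop[of _ t]) simp_all
  qed
  ultimately show ?thesis
    unfolding query_def Let_def by blast
qed

section \<open>Self-referential queries\<close>

lemma eval_Cn1: "eval g xs a \<Longrightarrow> eval f [a] z \<Longrightarrow> eval (Cn f [g]) xs z"
  by (rule eval.intros(4)[where ys = "[a]"]) auto

lemma eval_Cn2: "eval g xs a \<Longrightarrow> eval h xs b \<Longrightarrow> eval f [a, b] z \<Longrightarrow> eval (Cn f [g, h]) xs z"
  by (rule eval.intros(4)[where ys = "[a, b]"]) auto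

lemma eval_Cn3:
  "eval g xs a \<Longrightarrow> eval h xs b \<Longrightarrow> eval k xs c \<Longrightarrow> eval f [a, b, c] z \<Longrightarrow> eval (Cn f [g, h, k]) xs z"
  by (rule eval.intros(4)[where ys = "[a, b, c]"]) auto

lemma eval_Id: "i < length xs \<Longrightarrow> y = xs ! i \<Longrightarrow> eval (Id i) xs y"
  using eval.intros(3) by simp

lemma eval_S: "eval S [x] (Suc x)"
  by (rule eval.intros)

primrec r_const :: "nat \<Rightarrow> recf" where
  "r_const 0 = Z"
| "r_const (Suc n) = Cn S [r_const n]"

lemma eval_const: "eval (r_const n) xs n"
  by (induction n) (auto intro: eval.intros(1) eval_Cn1 eval_S)

definition r_add :: recf where "r_add = Pr (Id 0) (Cn S [Id 1])"

lemma eval_add: "eval r_add [x, y] (x + y)"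
  unfolding r_add_def
proof (induction x)
  case 0
  show ?case by (intro eval.intros(5) eval_Id) auto
next
  case (Suc x)
  have "eval (Cn S [Id 1]) [x, x + y, y] (Suc (x + y))"
    by (intro eval_Cn1[OF eval_Id eval_S]) auto
  with Suc show ?case using eval.intros(6) by simp
qed

definition r_pred :: recf where "r_pred = Pr Z (Id 0)"

lemma eval_pred: "eval r_pred [x] (x - 1)"
  unfolding r_pred_def
proof (induction x)
  case 0
  show ?case using eval.intros(5)[OF eval.intros(1)] by simp
next
  case (Suc x)
  have "eval (Id 0) [x, x - 1] (Suc x - 1)" by (intro eval_Id) auto
  with Suc show ?case by (rule eval.intros(6))
qed

text \<open>The recursion runs on the first argument, which is therefore the subtrahend.\<close>

definition r_sub :: recf where "r_sub = Pr (Id 0) (Cn r_pred [Id 1])"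

lemma eval_sub: "eval r_sub [x, y] (y - x)"
  unfolding r_sub_def
proof (induction x)
  case 0
  show ?case by (intro eval.intros(5) eval_Id) auto
next
  case (Suc x)
  have "eval (Cn r_pred [Id 1]) [x, y - x, y] (y - x - 1)"
    by (intro eval_Cn1[OF eval_Id eval_pred]) auto
  with Suc have "eval (Pr (Id 0) (Cn r_pred [Id 1])) [Suc x, y] (y - x - 1)"
    by (rule eval.intros(6))
  then show ?case by simp
qed

definition r_triangle :: recf where "r_triangle = Pr Z (Cn S [Cn r_add [Id 0, Id 1]])"

lemma eval_triangle: "eval r_triangle [x] (triangle x)"
  unfolding r_triangle_def
proof (induction x)
  case 0
  show ?case using eval.intros(5)[OF eval.intros(1)] by simp
next
  case (Suc x)
  have "eval (Cn S [Cn r_add [Id 0, Id 1]]) [x, triangle x] (Suc (x + triangle x))"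
    by (intro eval_Cn1[OF eval_Cn2[OF eval_Id eval_Id eval_add] eval_S]) auto
  with Suc have "eval (Pr Z (Cn S [Cn r_add [Id 0, Id 1]])) [Suc x] (Suc (x + triangle x))"
    by (rule eval.intros(6))
  then show ?case by (simp add: add.commute)
qed

definition r_pair :: recf where "r_pair = Cn r_add [Cn r_triangle [r_add], Id 0]"

lemma eval_pair: "eval r_pair [x, y] (prod_encode (x, y))"
proof -
  have "eval r_pair [x, y] (triangle (x + y) + x)"
    unfolding r_pair_def
    by (intro eval_Cn2[OF eval_Cn1[OF eval_add eval_triangle] eval_Id eval_add]) auto
  then show ?thesis by (simp add: prod_encode_def)
qed

lemma triangle_mono: "m \<le> n \<Longrightarrow> triangle m \<le> triangle n"
  by (induction n) (auto simp: le_Suc_eq)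

text \<open>\<open>prod_encode (a, b) = triangle (a + b) + a\<close> lies in the interval from \<open>triangle (a + b)\<close> to
  \<open>triangle (a + b + 1) - 1\<close>, so \<open>a + b\<close> is found by a search.\<close>

definition r_sum :: recf where
  "r_sum = Mn (Cn r_sub [Cn r_triangle [Cn S [Id 0]], Cn S [Id 1]])"

lemma eval_sum: "eval r_sum [prod_encode (a, b)] (a + b)"
  unfolding r_sum_def
proof (rule eval.intros(7))
  let ?f = "Cn r_sub [Cn r_triangle [Cn S [Id 0]], Cn S [Id 1]]"
  have f: "eval ?f [m, n] (Suc n - triangle (Suc m))" for m n
    by (intro eval_Cn2[OF eval_Cn1[OF eval_Cn1[OF eval_Id eval_S] eval_triangle]
          eval_Cn1[OF eval_Id eval_S] eval_sub]) auto
  show "eval ?f [a + b, prod_encode (a, b)] 0"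
    using f[of "a + b" "prod_encode (a, b)"] by (simp add: prod_encode_def)
  fix m assume "m < a + b"
  then have "triangle (Suc m) \<le> triangle (a + b)" by (intro triangle_mono) simp
  then have "Suc (prod_encode (a, b)) - triangle (Suc m)
      = Suc (prod_encode (a, b) - triangle (Suc m))"
    by (simp add: prod_encode_def Suc_diff_le del: triangle_Suc)
  then show "\<exists>k. eval ?f [m, prod_encode (a, b)] (Suc k)"
    using f[of m "prod_encode (a, b)"] by metis
qed

definition r_fst :: recf where "r_fst = Cn r_sub [Cn r_triangle [r_sum], Id 0]"
definition r_snd :: recf where "r_snd = Cn r_sub [r_fst, r_sum]"

lemma eval_fst: "eval r_fst [n] (fst (prod_decode n))"
proof -
  obtain a b where n: "n = prod_encode (a, b)" by (metis prod_decode_inverse surj_pair)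
  have "eval r_fst [prod_encode (a, b)] (prod_encode (a, b) - triangle (a + b))"
    unfolding r_fst_def
    by (intro eval_Cn2[OF eval_Cn1[OF eval_sum eval_triangle] eval_Id eval_sub]) auto
  then show ?thesis by (simp add: n) (simp add: prod_encode_def)
qed

lemma eval_snd: "eval r_snd [n] (snd (prod_decode n))"
proof -
  obtain a b where n: "n = prod_encode (a, b)" by (metis prod_decode_inverse surj_pair)
  have "eval r_fst [n] a" using eval_fst[of n] by (simp add: n)
  then have "eval r_snd [n] (a + b - a)"
    unfolding r_snd_def n by (intro eval_Cn2[OF _ eval_sum eval_sub])
  then show ?thesis by (simp add: n)
qed

text \<open>The step function receives the counter, the list so far, the original tail and the
  element, hence \<open>Id 1\<close> and \<open>Id 3\<close>; \<open>S\<close> is the successor in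
  the definition of \<open>list_encode\<close>.\<close>

definition r_cons_iter :: recf where
  "r_cons_iter = Pr (Id 0) (Cn S [Cn r_pair [Id 3, Id 1]])"

lemma eval_cons_iter:
  "eval r_cons_iter [n, list_encode xs, c] (list_encode (replicate n c @ xs))"
  unfolding r_cons_iter_def
proof (induction n)
  case 0
  show ?case by (intro eval.intros(5) eval_Id) auto
next
  case (Suc n)
  let ?v = "list_encode (replicate n c @ xs)"
  have "eval (Cn S [Cn r_pair [Id 3, Id 1]]) [n, ?v, list_encode xs, c] (Suc (prod_encode (c, ?v)))"
    by (intro eval_Cn1[OF eval_Cn2[OF eval_Id eval_Id eval_pair] eval_S]) auto
  with Suc show ?case using eval.intros(6) by simp
qed

text \<open>An input \<open>n\<close> that contains, as its first component, the codes of the fixed parts of the query is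
  mapped to the code of the query for \<open>n\<close>.\<close>

definition r_query :: recf where
  "r_query = (let a = Cn r_fst [r_fst]; b = Cn r_snd [r_fst] in
     Cn r_pair [Cn S [Cn r_pair [Cn r_fst [a], Cn r_cons_iter [Id 0, Cn r_fst [b], Cn r_snd [a]]]],
       Cn r_snd [b]])"

lemma eval_query:
  assumes "n = prod_encode (prod_encode (prod_encode (form_code \<phi>, form_code \<psi>),
      prod_encode (list_encode (map form_code \<Gamma>), form_code \<delta>)), z)"
  shows "eval r_query [n] (seq_code (\<phi> # replicate n \<psi> @ \<Gamma> \<turnstile> \<delta>))"
proof -
  let ?a = "Cn r_fst [r_fst]" and ?b = "Cn r_snd [r_fst]"
  have a: "eval ?a [n] (prod_encode (form_code \<phi>, form_code \<psi>))"
    and b: "eval ?b [n] (prod_encode (list_encode (map form_code \<Gamma>), form_code \<delta>))"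
    using eval_Cn1[OF eval_fst eval_fst, of n] eval_Cn1[OF eval_fst eval_snd, of n] assms by simp_all
  have "eval (Cn r_fst [?a]) [n] (form_code \<phi>)" "eval (Cn r_snd [?a]) [n] (form_code \<psi>)"
    "eval (Cn r_fst [?b]) [n] (list_encode (map form_code \<Gamma>))" "eval (Cn r_snd [?b]) [n] (form_code \<delta>)"
    using eval_Cn1[OF a eval_fst] eval_Cn1[OF a eval_snd] eval_Cn1[OF b eval_fst] eval_Cn1[OF b eval_snd]
    by simp_all
  then have "eval r_query [n] (prod_encode (Suc (prod_encode (form_code \<phi>,
      list_encode (replicate n (form_code \<psi>) @ map form_code \<Gamma>))), form_code \<delta>))"
    unfolding r_query_def Let_def
    by (intro eval_Cn2[OF eval_Cn1[OF eval_Cn2[OF _ eval_Cn3[OF eval_Id _ _ eval_cons_iter] eval_pair] eval_S] _ eval_pair])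
      auto
  then show ?thesis by simp
qed

section \<open>Diagonalisation against the logic\<close>

lemma eval_Cn_iff:
  assumes "eval g xs a"
  shows "eval (Cn f [g]) xs y \<longleftrightarrow> eval f [a] y"
proof
  assume "eval (Cn f [g]) xs y"
  then obtain ys where "list_all2 (\<lambda>g y. eval g xs y) [g] ys" "eval f ys y"
    by (rule eval_CnE)
  then obtain b where "eval g xs b" "eval f [b] y" by (auto simp: list_all2_Cons1)
  then show "eval f [a] y" using eval_deterministic[OF assms] by blast
qed (rule eval_Cn1[OF assms])

text \<open>A search in which the tested value ignores the search variable turns a computed answer
  into halting or divergence.\<close>

lemma eval_Mn_const_iff:
  assumes "\<And>m. eval f (m # xs) v"
  shows "(\<exists>y. eval (Mn f) xs y) \<longleftrightarrow> v = 0"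
proof
  assume "\<exists>y. eval (Mn f) xs y"
  then obtain y where "eval f (y # xs) 0" by (auto elim: eval_MnE)
  then show "v = 0" using eval_deterministic assms by blast
next
  assume "v = 0"
  then have "eval (Mn f) xs 0" using assms[of 0] by (intro eval.intros(7)) auto
  then show "\<exists>y. eval (Mn f) xs y" ..
qed

text \<open>There is no circle: \<open>r_query\<close> is one fixed function, so \<open>f\<close>
  and \<open>g\<close> may call it; they determine the program and thereby \<open>u\<close>, and
  only then is the input formed from \<open>u\<close> and \<open>z\<close>.\<close>

lemma self_referential_query:
  "\<exists>u. \<forall>z. \<exists>s. let n = prod_encode (u, z) in
    eval r_query [n] (seq_code s) \<and>
    ((\<exists>y. eval f [n] y) \<and> (\<nexists>y. eval g [n] y) \<longrightarrow> s \<in> ACT) \<and>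
    ((\<exists>y. eval g [n] y) \<and> (\<nexists>y. eval f [n] y) \<longrightarrow> s \<notin> ACT_omega_D)"
proof -
  obtain \<phi> \<psi> \<Gamma> \<delta> where q: "\<forall>n. let s = (\<phi> # replicate n \<psi> @ \<Gamma> \<turnstile> \<delta>) in
    ((\<exists>y. eval f [n] y) \<and> (\<nexists>y. eval g [n] y) \<longrightarrow> s \<in> ACT) \<and>
    ((\<exists>y. eval g [n] y) \<and> (\<nexists>y. eval f [n] y) \<longrightarrow> s \<notin> ACT_omega_D)"
    using query_exists[of f g] by blast
  define u where "u = prod_encode (prod_encode (form_code \<phi>, form_code \<psi>),
      prod_encode (list_encode (map form_code \<Gamma>), form_code \<delta>))"
  show ?thesis
  proof (intro exI[of _ u] allI)
    fix z
    let ?n = "prod_encode (u, z)"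
    show "\<exists>s. let n = prod_encode (u, z) in
      eval r_query [n] (seq_code s) \<and>
      ((\<exists>y. eval f [n] y) \<and> (\<nexists>y. eval g [n] y) \<longrightarrow> s \<in> ACT) \<and>
      ((\<exists>y. eval g [n] y) \<and> (\<nexists>y. eval f [n] y) \<longrightarrow> s \<notin> ACT_omega_D)"
      using q eval_query[of ?n \<phi> \<psi> \<Gamma> \<delta> z]
      by (intro exI[of _ "\<phi> # replicate ?n \<psi> @ \<Gamma> \<turnstile> \<delta>"]) (simp add: Let_def u_def)
  qed
qed

text \<open>A liar argument: the accepting search halts if the query is outside \<open>L\<close>,
  the rejecting one if it is inside. Exactly one of them halts, and either outcome contradicts an
  inclusion.\<close>

lemma not_decidable_between:
  assumes "ACT \<subseteq> L" "L \<subseteq> ACT_omega_D"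
  shows "\<not> decidable (seq_code ` L)"
proof
  assume "decidable (seq_code ` L)"
  then obtain \<chi> where \<chi>: "\<And>x. eval \<chi> [x] (if x \<in> seq_code ` L then 1 else 0)"
    by (auto simp: decidable_def computable_def)
  \<comment> \<open>\<open>Id 1\<close> skips the search variable and passes the input on.\<close>
  let ?f = "Mn (Cn \<chi> [Cn r_query [Id 1]])"
  let ?g = "Mn (Cn r_sub [Cn \<chi> [Cn r_query [Id 1]], r_const 1])"
  obtain u where u: "\<forall>z. \<exists>s. let n = prod_encode (u, z) in
    eval r_query [n] (seq_code s) \<and>
    ((\<exists>y. eval ?f [n] y) \<and> (\<nexists>y. eval ?g [n] y) \<longrightarrow> s \<in> ACT) \<and>
    ((\<exists>y. eval ?g [n] y) \<and> (\<nexists>y. eval ?f [n] y) \<longrightarrow> s \<notin> ACT_omega_D)"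
    using self_referential_query by blast
  define n where "n = prod_encode (u, 0)"
  obtain s where s: "eval r_query [n] (seq_code s)"
    "(\<exists>y. eval ?f [n] y) \<Longrightarrow> (\<nexists>y. eval ?g [n] y) \<Longrightarrow> s \<in> ACT"
    "(\<exists>y. eval ?g [n] y) \<Longrightarrow> (\<nexists>y. eval ?f [n] y) \<Longrightarrow> s \<notin> ACT_omega_D"
    using spec[OF u, of 0] unfolding Let_def n_def by blast
  define v where "v = (if s \<in> L then 1 else 0 :: nat)"
  have "seq_code s \<in> seq_code ` L \<longleftrightarrow> s \<in> L"
    by (rule inj_image_mem_iff[OF inj_seq_code])
  then have v: "eval \<chi> [seq_code s] v" using \<chi>[of "seq_code s"] by (simp add: v_def)
  have f: "eval (Cn \<chi> [Cn r_query [Id 1]]) (m # [n]) v" for m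
    by (rule eval_Cn1[OF eval_Cn1[OF eval_Id s(1)] v]) auto
  have g: "eval (Cn r_sub [Cn \<chi> [Cn r_query [Id 1]], r_const 1]) (m # [n]) (1 - v)" for m
    by (rule eval_Cn2[OF f eval_const eval_sub])
  have "(\<exists>y. eval ?f [n] y) \<longleftrightarrow> s \<notin> L" "(\<exists>y. eval ?g [n] y) \<longleftrightarrow> s \<in> L"
    using eval_Mn_const_iff[OF f] eval_Mn_const_iff[OF g] by (auto simp: v_def)
  then show False
    using s(2,3) assms by blast
qed

lemma Sigma1_complete_between:
  assumes "ACT \<subseteq> L" "L \<subseteq> ACT_omega_D" "r_e (seq_code ` L)"
  shows "Sigma1_complete (seq_code ` L)"
  unfolding Sigma1_complete_def
proof (intro conjI allI impI)
  fix A assume "r_e A"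
  then obtain f where f: "\<And>x. x \<in> A \<longleftrightarrow> (\<exists>y. eval f [x] y)"
    by (auto simp: r_e_def)
  obtain g where g: "\<And>x. x \<in> seq_code ` L \<longleftrightarrow> (\<exists>y. eval g [x] y)"
    using assms(3) by (auto simp: r_e_def)
  \<comment> \<open>\<open>?f\<close> tests the instance \<open>z\<close> contained in the input,
    \<open>?g\<close> the input's own query.\<close>
  let ?f = "Cn f [r_snd]" and ?g = "Cn g [r_query]"
  obtain u where u: "\<forall>z. \<exists>s. let n = prod_encode (u, z) in
    eval r_query [n] (seq_code s) \<and>
    ((\<exists>y. eval ?f [n] y) \<and> (\<nexists>y. eval ?g [n] y) \<longrightarrow> s \<in> ACT) \<and>
    ((\<exists>y. eval ?g [n] y) \<and> (\<nexists>y. eval ?f [n] y) \<longrightarrow> s \<notin> ACT_omega_D)"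
    using self_referential_query by blast
  then obtain s where s: "\<And>z. eval r_query [prod_encode (u, z)] (seq_code (s z))"
    "\<And>z. (\<exists>y. eval ?f [prod_encode (u, z)] y) \<Longrightarrow> (\<nexists>y. eval ?g [prod_encode (u, z)] y) \<Longrightarrow> s z \<in> ACT"
    "\<And>z. (\<exists>y. eval ?g [prod_encode (u, z)] y) \<Longrightarrow> (\<nexists>y. eval ?f [prod_encode (u, z)] y) \<Longrightarrow>
      s z \<notin> ACT_omega_D"
    unfolding Let_def by metis
  have "eval (Cn r_query [Cn r_pair [r_const u, Id 0]]) [z] (seq_code (s z))" for z
    by (rule eval_Cn1[OF eval_Cn2[OF eval_const eval_Id eval_pair] s(1)]) auto
  then have "computable (\<lambda>z. seq_code (s z))"
    unfolding computable_def by blast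
  moreover have "z \<in> A \<longleftrightarrow> seq_code (s z) \<in> seq_code ` L" for z
  proof -
    have "(\<exists>y. eval ?f [prod_encode (u, z)] y) \<longleftrightarrow> z \<in> A"
      using eval_Cn_iff[OF eval_snd, of f "prod_encode (u, z)"] f[of z] by simp
    moreover have "(\<exists>y. eval ?g [prod_encode (u, z)] y) \<longleftrightarrow> s z \<in> L"
      using eval_Cn_iff[OF s(1), of g z] g[of "seq_code (s z)"] inj_image_mem_iff[OF inj_seq_code] by simp
    ultimately show ?thesis
      using s(2,3)[of z] assms(1,2) inj_image_mem_iff[OF inj_seq_code] by blast
  qed
  ultimately show "A \<le>\<^sub>m seq_code ` L"
    unfolding many_one_reducible_def by blast
qed (rule assms)

theorem theorem9:
  fixes L :: "sequent set"
  assumes "ACT \<subseteq> L" and "L \<subseteq> ACT_omega_D"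
  shows "\<not> decidable_logic L \<and> (r_e_logic L \<longrightarrow> Sigma1_complete_logic L)"
  unfolding decidable_logic_def r_e_logic_def Sigma1_complete_logic_def
  using not_decidable_between[OF assms] Sigma1_complete_between[OF assms] by blast

end
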